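(* Let $P(\lambda)=\sum_{j=0}^m\lambda^jA_j\in\mathbb{C}[\lambda]^{n\times n}$ be regular, $B\in\mathbb{C}^{n\times r}$, $C\in\mathbb{C}^{r\times n}$, $D\in\mathbb{C}^{r\times r}$, and let $\Sigma_1$ be the higher order state-space system $$P\left(\tfrac{d}{dt}\right)x(t)=Bu(t),\qquad y(t)=Cx(t)+Du(t),$$ with system matrix $\mathcal{S}(\lambda)=\begin{bmatrix}-P(\lambda)&B\\ C&D\end{bmatrix}$. Let $\sigma:\{0,\ldots,m-1\}\to\{1,\ldots,m\}$ be a bijection with $\mathrm{CISS}(\sigma)=(c_1,i_1,\ldots,c_l,i_l)$, let $L_\sigma(\lambda)=\lambda M_m-M_\sigma$ be the Fiedler pencil of $P(\lambda)$ associated with $\sigma$, and let $\mathbb{S}_\sigma(\lambda)$, $F_\sigma(P)$ and $K_\sigma(P)$ be as defined in the context. Then: (1) The state-space system $\Sigma_2$ associated with $\mathbb{S}_\sigma(\lambda)$ is (with $\lambda$ standing for $\frac{d}{dt}$) $$\lambda M_mX=M_\sigma X+K_\sigma(P)^TBu,\qquad y=CF_\sigma(P)X+Du,$$ and the state vector $x$ of $\Sigma_1$ is given by $x=F_\sigma(P)X$; that is, whenever $(X,u,y)$ satisfies $\Sigma_2$, $(F_\sigma(P)X,u,y)$ satisfies $\Sigma_1$. (2) Explicitly, $\Sigma_2$ is given by $$\lambda M_mX=M_\sigma X+(e_m\otimes B)u,\quad y=(e_{m-c_1}^T\otimes C)X+Du\qquad\text{if } c_1>0,$$ $$\lambda M_mX=M_\sigma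 X+(e_{m-i_1}\otimes B)u,\quad y=(e_m^T\otimes C)X+Du\qquad\text{if } c_1=0,$$ and $x=(e_{m-c_1}^T\otimes I_n)X$. (3) $\Sigma_1$ is strict system equivalent to $\Sigma_2$, i.e. the system matrices $\mathcal{S}(\lambda)$ and $\mathbb{S}_\sigma(\lambda)$ are strict system equivalent.
   Context: A square matrix polynomial is regular if its determinant is not identically zero, and unimodular if its determinant is a nonzero constant. $e_j$ is the $j$-th column of $I_m$; $\otimes$ is the Kronecker product. Signals $x,X,u,y$ are smooth vector functions of $t$. Fiedler matrices of $P$ ($nm\times nm$): $M_0=\mathrm{diag}(I_{(m-1)n},-A_0)$; $M_m=\mathrm{diag}(A_m,I_{(m-1)n})$; for $i=1,\ldots,m-1$, $M_i=\mathrm{diag}\left(I_{(m-i-1)n},\begin{bmatrix}-A_i&I_n\\ I_n&0\end{bmatrix},I_{(i-1)n}\right)$; $M_\sigma:=M_{\sigma^{-1}(1)}\cdots M_{\sigma^{-1}(m)}$. $\sigma$ has a consecution at $d\in\{0,\ldots,m-2\}$ if $\sigma(d)<\sigma(d+1)$ and an inversion at $d$ if $\sigma(d)>\sigma(d+1)$. $\mathrm{CISS}(\sigma)=(c_1,i_1,\ldots,c_l,i_l)$ means that $\sigma$ has $c_1$ consecutive consecutions at $0,\ldots,c_1-1$, then $i_1$ consecutive inversions at $c_1,\ldots,c_1+i_1-1$, and so on, up to $i_l$ inversions at $m-1-i_l,\ldots,m-2$ (only $c_1$ and $i_l$ may be zero; for $m=1$ the sequence is $(0,0)$). The Fiedler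 pencil of $\mathcal{S}(\lambda)$ associated with $\sigma$ is $\mathbb{S}_\sigma(\lambda)=\begin{bmatrix}-L_\sigma(\lambda)&e_m\otimes B\\ e_{m-c_1}^T\otimes C&D\end{bmatrix}$ if $c_1>0$, and $\mathbb{S}_\sigma(\lambda)=\begin{bmatrix}-L_\sigma(\lambda)&e_{m-i_1}\otimes B\\ e_m^T\otimes C&D\end{bmatrix}$ if $c_1=0$. The state-space system associated with it is $\mathbb{S}_\sigma(\frac{d}{dt})\begin{bmatrix}X\\ u\end{bmatrix}=\begin{bmatrix}0\\ y\end{bmatrix}$. The maps $F_\sigma(P),K_\sigma(P)$. It is known that there are unimodular $U(\lambda),V(\lambda)\in\mathbb{C}[\lambda]^{nm\times nm}$ with $U(\lambda)L_\sigma(\lambda)V(\lambda)=\mathrm{diag}(I_{(m-1)n},P(\lambda))$ such that $F_\sigma(P):=(e_m^T\otimes I_n)V(\lambda)^{-1}$ equals $e_{m-c_1}^T\otimes I_n$ and $K_\sigma(P):=(e_m^T\otimes I_n)(U(\lambda)^{-1})^T$ equals $e_m^T\otimes I_n$ if $c_1>0$ and $e_{m-i_1}^T\otimes I_n$ if $c_1=0$; fix such $U,V$. Strict system equivalence. For $k=1,2$ let $\mathcal{S}_k(\lambda)=\begin{bmatrix}A_k(\lambda)&B_k(\lambda)\\ C_k(\lambda)&D_k(\lambda)\end{bmatrix}$ be polynomial matrices with $A_k\in\mathbb{C}[\lambda]^{r_k\times r_k}$ regular, $B_k\in\mathbb{C}[\lambda]^{r_k\times s}$, $C_k\in\mathbb{C}[\lambda]^{p\times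 r_k}$, $D_k\in\mathbb{C}[\lambda]^{p\times s}$, and $n_k=\deg\det A_k(\lambda)$. For $q\ge\max\{n_1,n_2\}$ (with $q\ge r_1,r_2$) put $\mathcal{S}_k^e(\lambda)=\begin{bmatrix}I_{q-r_k}&0&0\\ 0&A_k(\lambda)&B_k(\lambda)\\ 0&C_k(\lambda)&D_k(\lambda)\end{bmatrix}$. Then $\mathcal{S}_1$ and $\mathcal{S}_2$ are strict system equivalent if (for such a $q$) there exist unimodular $\tilde U(\lambda),\tilde V(\lambda)\in\mathbb{C}[\lambda]^{q\times q}$ and $\tilde X(\lambda)\in\mathbb{C}[\lambda]^{p\times q}$, $\tilde Y(\lambda)\in\mathbb{C}[\lambda]^{q\times s}$ with $\begin{bmatrix}\tilde U&0\\ \tilde X&I_p\end{bmatrix}\mathcal{S}_1^e=\mathcal{S}_2^e\begin{bmatrix}\tilde V&\tilde Y\\ 0&I_s\end{bmatrix}$. Here the state blocks are $-P(\lambda)$ and $-L_\sigma(\lambda)$. *)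

theory Defs
  imports "HOL-Analysis.Derivative" "Jordan_Normal_Form.Determinant"
begin

section \<open>Matrices and polynomial matrices\<close>

text \<open>A polynomial matrix is a matrix over \<^typ>\<open>complex poly\<close>, the variable being
  \<open>\<lambda>\<close>. Constant matrices are embedded by \<open>const_mat\<close>.\<close>

definition const_mat :: "complex mat \<Rightarrow> complex poly mat" where
  "const_mat M = map_mat (\<lambda>a. [:a:]) M"

definition matrix_poly :: "nat \<Rightarrow> nat \<Rightarrow> (nat \<Rightarrow> complex mat) \<Rightarrow> complex poly mat" where
  "matrix_poly n m A = mat n n (\<lambda>ij. \<Sum>j\<le>m. monom (A j $$ ij) j)"

definition regular_mat :: "complex poly mat \<Rightarrow> bool" where
  "regular_mat M \<longleftrightarrow> square_mat M \<and> det M \<noteq> 0"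

definition unimodular_mat :: "complex poly mat \<Rightarrow> bool" where
  "unimodular_mat M \<longleftrightarrow> square_mat M \<and> (\<exists>c. c \<noteq> 0 \<and> det M = [:c:])"

text \<open>The inverse over \<open>\<complex>[\<lambda>]\<close>; it exists for unimodular matrices.\<close>

definition mat_inv :: "complex poly mat \<Rightarrow> complex poly mat" where
  "mat_inv M = (THE W. W \<in> carrier_mat (dim_row M) (dim_row M)
      \<and> inverts_mat M W \<and> inverts_mat W M)"

definition kron_mat :: "'a::semiring_1 mat \<Rightarrow> 'a mat \<Rightarrow> 'a mat" (infixl \<open>\<otimes>\<^sub>K\<close> 75) where
  "M \<otimes>\<^sub>K N = mat (dim_row M * dim_row N) (dim_col M * dim_col N)
     (\<lambda>(i, j). M $$ (i div dim_row N, j div dim_col N) * N $$ (i mod dim_row N, j mod dim_col N))"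

text \<open>\<open>unit_col m j\<close> is the \<open>m \<times> 1\<close> matrix \<open>e\<^sub>j\<close>, with \<open>j\<close> counted from 1.\<close>

definition unit_col :: "nat \<Rightarrow> nat \<Rightarrow> complex mat" where
  "unit_col m j = mat_of_cols m [col (1\<^sub>m m) (j - 1)]"

abbreviation unit_row :: "nat \<Rightarrow> nat \<Rightarrow> complex mat" where
  "unit_row m j \<equiv> transpose_mat (unit_col m j)"

section \<open>Consecutions, inversions and Fiedler pencils\<close>

definition consecution :: "(nat \<Rightarrow> nat) \<Rightarrow> nat \<Rightarrow> bool" where
  "consecution \<sigma> d \<longleftrightarrow> \<sigma> d < \<sigma> (d + 1)"

definition inversion :: "(nat \<Rightarrow> nat) \<Rightarrow> nat \<Rightarrow> bool" where
  "inversion \<sigma> d \<longleftrightarrow> \<sigma> d > \<sigma> (d + 1)"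

definition ciss_start :: "(nat \<times> nat) list \<Rightarrow> nat \<Rightarrow> nat" where
  "ciss_start cs k = (\<Sum>(c, i)\<leftarrow>take k cs. c + i)"

text \<open>\<open>CISS(\<sigma>) = (c\<^sub>1, i\<^sub>1, \<dots>, c\<^sub>l, i\<^sub>l)\<close> is represented by the list of pairs
  \<open>[(c\<^sub>1, i\<^sub>1), \<dots>, (c\<^sub>l, i\<^sub>l)]\<close>, so that list index \<open>k\<close> holds \<open>(c\<^sub>k\<^sub>+\<^sub>1, i\<^sub>k\<^sub>+\<^sub>1)\<close>.\<close>

definition is_CISS :: "nat \<Rightarrow> (nat \<Rightarrow> nat) \<Rightarrow> (nat \<times> nat) list \<Rightarrow> bool" where
  "is_CISS m \<sigma> cs \<longleftrightarrow>
     cs \<noteq> [] \<and> ciss_start cs (length cs) = m - 1 \<and>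
     (\<forall>k < length cs. case cs ! k of (c, i) \<Rightarrow>
        (\<forall>d \<in> {ciss_start cs k ..< ciss_start cs k + c}. consecution \<sigma> d) \<and>
        (\<forall>d \<in> {ciss_start cs k + c ..< ciss_start cs k + c + i}. inversion \<sigma> d) \<and>
        (0 < k \<longrightarrow> 0 < c) \<and> (k + 1 < length cs \<longrightarrow> 0 < i))"

definition fiedler_mat :: "nat \<Rightarrow> nat \<Rightarrow> (nat \<Rightarrow> complex mat) \<Rightarrow> nat \<Rightarrow> complex mat" where
  "fiedler_mat n m A i =
     (if i = 0 then diag_block_mat [1\<^sub>m ((m - 1) * n), - A 0]
      else if i = m then diag_block_mat [A m, 1\<^sub>m ((m - 1) * n)]
      else diag_block_mat [1\<^sub>m ((m - i - 1) * n),
                           four_block_mat (- A i) (1\<^sub>m n) (1\<^sub>m n) (0\<^sub>m n n),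
                           1\<^sub>m ((i - 1) * n)])"

definition fiedler_prod :: "nat \<Rightarrow> nat \<Rightarrow> (nat \<Rightarrow> complex mat) \<Rightarrow> (nat \<Rightarrow> nat) \<Rightarrow> complex mat" where
  "fiedler_prod n m A \<sigma> =
     foldr (*) (map (\<lambda>k. fiedler_mat n m A (inv_into {0..<m} \<sigma> k)) [1..<m+1]) (1\<^sub>m (m * n))"

definition fiedler_pencil :: "nat \<Rightarrow> nat \<Rightarrow> (nat \<Rightarrow> complex mat) \<Rightarrow> (nat \<Rightarrow> nat) \<Rightarrow> complex poly mat" where
  "fiedler_pencil n m A \<sigma> =
     [:0, 1:] \<cdot>\<^sub>m const_mat (fiedler_mat n m A m) - const_mat (fiedler_prod n m A \<sigma>)"

text \<open>\<open>F\<^sub>\<sigma>(P)\<close> and \<open>K\<^sub>\<sigma>(P)\<close>, as functions of the unimodular matrices \<open>V\<close> and \<open>U\<close> that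
  reduce the pencil.\<close>

definition fiedler_F :: "nat \<Rightarrow> nat \<Rightarrow> complex poly mat \<Rightarrow> complex poly mat" where
  "fiedler_F n m V = const_mat (unit_row m m \<otimes>\<^sub>K 1\<^sub>m n) * mat_inv V"

definition fiedler_K :: "nat \<Rightarrow> nat \<Rightarrow> complex poly mat \<Rightarrow> complex poly mat" where
  "fiedler_K n m U = const_mat (unit_row m m \<otimes>\<^sub>K 1\<^sub>m n) * transpose_mat (mat_inv U)"

definition fiedler_reduction ::
  "nat \<Rightarrow> nat \<Rightarrow> (nat \<Rightarrow> complex mat) \<Rightarrow> (nat \<Rightarrow> nat) \<Rightarrow> nat \<Rightarrow> nat
    \<Rightarrow> complex poly mat \<Rightarrow> complex poly mat \<Rightarrow> bool" where
  "fiedler_reduction n m A \<sigma> c1 i1 U V \<longleftrightarrow>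
     U \<in> carrier_mat (m * n) (m * n) \<and> unimodular_mat U \<and>
     V \<in> carrier_mat (m * n) (m * n) \<and> unimodular_mat V \<and>
     U * fiedler_pencil n m A \<sigma> * V = diag_block_mat [1\<^sub>m ((m - 1) * n), matrix_poly n m A] \<and>
     fiedler_F n m V = const_mat (unit_row m (m - c1) \<otimes>\<^sub>K 1\<^sub>m n) \<and>
     fiedler_K n m U =
       const_mat ((if c1 > 0 then unit_row m m else unit_row m (m - i1)) \<otimes>\<^sub>K 1\<^sub>m n)"

section \<open>System matrices and strict system equivalence\<close>

text \<open>A system matrix together with its partition is the quadruple of its blocks
  \<open>(A, B, C, D)\<close>, with state block \<open>A\<close>.\<close>

type_synonym poly_system =
  "complex poly mat \<times> complex poly mat \<times> complex poly mat \<times> complex poly mat"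

fun system_mat :: "poly_system \<Rightarrow> complex poly mat" where
  "system_mat (A, B, C, D) = four_block_mat A B C D"

fun wf_system :: "nat \<Rightarrow> nat \<Rightarrow> poly_system \<Rightarrow> bool" where
  "wf_system p s (A, B, C, D) \<longleftrightarrow>
     regular_mat A \<and> B \<in> carrier_mat (dim_row A) s \<and>
     C \<in> carrier_mat p (dim_row A) \<and> D \<in> carrier_mat p s"

fun state_dim :: "poly_system \<Rightarrow> nat" where
  "state_dim (A, B, C, D) = dim_row A"

fun state_deg :: "poly_system \<Rightarrow> nat" where
  "state_deg (A, B, C, D) = degree (det A)"

definition extended_system_mat :: "nat \<Rightarrow> poly_system \<Rightarrow> complex poly mat" where
  "extended_system_mat q S = diag_block_mat [1\<^sub>m (q - state_dim S), system_mat S]"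

definition strict_system_equivalent :: "nat \<Rightarrow> nat \<Rightarrow> poly_system \<Rightarrow> poly_system \<Rightarrow> bool" where
  "strict_system_equivalent p s S1 S2 \<longleftrightarrow>
     wf_system p s S1 \<and> wf_system p s S2 \<and>
     (\<exists>q U V X Y.
        q \<ge> max (state_deg S1) (state_deg S2) \<and> q \<ge> state_dim S1 \<and> q \<ge> state_dim S2 \<and>
        U \<in> carrier_mat q q \<and> unimodular_mat U \<and> V \<in> carrier_mat q q \<and> unimodular_mat V \<and>
        X \<in> carrier_mat p q \<and> Y \<in> carrier_mat q s \<and>
        four_block_mat U (0\<^sub>m q p) X (1\<^sub>m p) * extended_system_mat q S1 =
        extended_system_mat q S2 * four_block_mat V Y (0\<^sub>m s q) (1\<^sub>m s))"

definition higher_order_system ::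
  "nat \<Rightarrow> nat \<Rightarrow> (nat \<Rightarrow> complex mat) \<Rightarrow> complex mat \<Rightarrow> complex mat \<Rightarrow> complex mat \<Rightarrow> poly_system" where
  "higher_order_system n m A B C D = (- matrix_poly n m A, const_mat B, const_mat C, const_mat D)"

definition fiedler_system ::
  "nat \<Rightarrow> nat \<Rightarrow> (nat \<Rightarrow> complex mat) \<Rightarrow> complex mat \<Rightarrow> complex mat \<Rightarrow> complex mat
    \<Rightarrow> (nat \<Rightarrow> nat) \<Rightarrow> nat \<Rightarrow> nat \<Rightarrow> poly_system" where
  "fiedler_system n m A B C D \<sigma> c1 i1 =
     (if c1 > 0
      then (- fiedler_pencil n m A \<sigma>, const_mat (unit_col m m \<otimes>\<^sub>K B),
            const_mat (unit_row m (m - c1) \<otimes>\<^sub>K C), const_mat D)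
      else (- fiedler_pencil n m A \<sigma>, const_mat (unit_col m (m - i1) \<otimes>\<^sub>K B),
            const_mat (unit_row m m \<otimes>\<^sub>K C), const_mat D))"

section \<open>Signals and differential systems\<close>

definition nth_vderiv :: "nat \<Rightarrow> (real \<Rightarrow> complex) \<Rightarrow> real \<Rightarrow> complex" where
  "nth_vderiv k = (\<lambda>f t. vector_derivative f (at t)) ^^ k"

definition smooth_fun :: "(real \<Rightarrow> complex) \<Rightarrow> bool" where
  "smooth_fun f \<longleftrightarrow> (\<forall>k t. nth_vderiv k f differentiable (at t))"

definition smooth_signal :: "nat \<Rightarrow> (real \<Rightarrow> complex vec) \<Rightarrow> bool" where
  "smooth_signal N x \<longleftrightarrow>
     (\<forall>t. x t \<in> carrier_vec N) \<and> (\<forall>i<N. smooth_fun (\<lambda>t. x t $ i))"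

text \<open>The action of \<open>M(d/dt)\<close> on a signal.\<close>

definition diff_op :: "complex poly mat \<Rightarrow> (real \<Rightarrow> complex vec) \<Rightarrow> real \<Rightarrow> complex vec" where
  "diff_op M x t = vec (dim_row M) (\<lambda>i. \<Sum>j<dim_col M. \<Sum>k\<le>degree (M $$ (i, j)).
      coeff (M $$ (i, j)) k * nth_vderiv k (\<lambda>s. x s $ j) t)"

definition higher_order_solution ::
  "nat \<Rightarrow> nat \<Rightarrow> nat \<Rightarrow> (nat \<Rightarrow> complex mat) \<Rightarrow> complex mat \<Rightarrow> complex mat \<Rightarrow> complex mat
    \<Rightarrow> (real \<Rightarrow> complex vec) \<Rightarrow> (real \<Rightarrow> complex vec) \<Rightarrow> (real \<Rightarrow> complex vec) \<Rightarrow> bool" where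
  "higher_order_solution n m r A B C D x u y \<longleftrightarrow>
     smooth_signal n x \<and> smooth_signal r u \<and> smooth_signal r y \<and>
     (\<forall>t. diff_op (matrix_poly n m A) x t = B *\<^sub>v u t) \<and>
     (\<forall>t. y t = C *\<^sub>v x t + D *\<^sub>v u t)"

text \<open>The system \<open>S(d/dt) [X; u] = [0; y]\<close> associated with a system matrix with
  \<open>r\<close> inputs and \<open>r\<close> outputs.\<close>

definition system_solution ::
  "nat \<Rightarrow> poly_system \<Rightarrow> (real \<Rightarrow> complex vec) \<Rightarrow> (real \<Rightarrow> complex vec) \<Rightarrow> (real \<Rightarrow> complex vec) \<Rightarrow> bool" where
  "system_solution r S X u y \<longleftrightarrow>
     smooth_signal (state_dim S) X \<and> smooth_signal r u \<and> smooth_signal r y \<and>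
     (\<forall>t. diff_op (system_mat S) (\<lambda>s. X s @\<^sub>v u s) t = 0\<^sub>v (state_dim S) @\<^sub>v y t)"

end

(*
Deleting the Fiedler factor with the highest index from the pencil lambda diag(Q, I) - W_{k+1}
takes one explicit unimodular transformation on each side; it splits off an identity block, replaces
the leading coefficient Q by lambda Q + A_{k+1}, a Horner step, and leaves the pencil of W_k.
Iterating gives L = U diag(I, P) V with explicit invertible U and V.  Along the way, the last block
row of V stays the first unit block row as long as sigma has consecutions and keeps its distance from
the bottom ever after; inversions play the same role for the last block column of U.  This yields F
and K, whence P F = (e_m^T U^{-1}) L and (e_m^T U^{-1}) K^T = I, so that F X solves the higher
order system.  Strict system equivalence is witnessed by U diag(-I, I) and V^{-1}.
*)
theory Submission
  imports Defs
begin

section \<open>Block rows and one reduction step\<close>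

text \<open>The top index is the one to delete because only the first diagonal block of the pencil
  carries a coefficient of \<lambda> other than the identity, and it meets A_{k+1} in the sum
  \<lambda> Q + A_{k+1}. A Fiedler block carrying this sum in place of A_{k+1} agrees, up to sign,
  with the pencil in its first block row or first block column, so one elimination clears the rest.
  Such a block is invertible without any division, whatever its entry, so all transformations stay
  polynomial. The new leading coefficient is no longer constant, which forces the induction to run
  over an arbitrary Q. The order given by \<sigma> enters only through neighbours: M_{k+1} commutes
  with every M_i for i < k, so a consecution at k lets it move to the right end of the product and
  an inversion to the left end. The algebra is done over a commutative ring to serve constant and
  polynomial matrices alike. It applies to signals because smooth functions form a module over
  C[\<lambda>], with \<lambda> acting as d/dt.\<close>

definition block_row :: "nat \<Rightarrow> nat \<Rightarrow> nat \<Rightarrow> 'a::comm_ring_1 mat" where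
  "block_row n N p = mat n N (\<lambda>(i, j). if j = p + i then 1 else 0)"

lemma block_row_carrier [simp]: "block_row n N p \<in> carrier_mat n N"
  by (simp add: block_row_def)

lemma dim_block_row [simp]: "dim_row (block_row n N p) = n" "dim_col (block_row n N p) = N"
  by (simp_all add: block_row_def)

lemma index_block_row [simp]:
  "i < n \<Longrightarrow> j < N \<Longrightarrow> block_row n N p $$ (i, j) = (if j = p + i then 1 else 0)"
  by (simp add: block_row_def)

lemma block_row_mult:
  fixes M :: "'a::comm_ring_1 mat"
  assumes "M \<in> carrier_mat N c" "p + n \<le> N"
  shows "block_row n N p * M = mat n c (\<lambda>(i, j). M $$ (p + i, j))"
proof (rule eq_matI)
  fix i j assume ij: "i < dim_row (mat n c (\<lambda>(i, j). M $$ (p + i, j)))" "j < dim_col (mat n c (\<lambda>(i, j). M $$ (p + i, j)))"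
  have "(block_row n N p * M) $$ (i, j) = (\<Sum>k = 0..<N. (if k = p + i then 1 else 0) * M $$ (k, j))"
    using assms ij by (simp add: times_mat_def scalar_prod_def)
  also have "\<dots> = (\<Sum>k = 0..<N. if k = p + i then M $$ (k, j) else 0)"
    by (rule sum.cong) auto
  also have "\<dots> = M $$ (p + i, j)" using assms ij by simp
  finally show "(block_row n N p * M) $$ (i, j) = mat n c (\<lambda>(i, j). M $$ (p + i, j)) $$ (i, j)"
    using ij by simp
qed (use assms in auto)

lemma mult_block_col:
  fixes M :: "'a::comm_ring_1 mat"
  assumes "M \<in> carrier_mat r N" "p + n \<le> N"
  shows "M * transpose_mat (block_row n N p) = mat r n (\<lambda>(i, j). M $$ (i, p + j))"
proof -
  have "transpose_mat (M * transpose_mat (block_row n N p)) = block_row n N p * transpose_mat M"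
    using assms by (subst transpose_mult) auto
  also have "\<dots> = mat n r (\<lambda>(i, j). transpose_mat M $$ (p + i, j))"
    using assms by (intro block_row_mult) auto
  finally have "M * transpose_mat (block_row n N p) = transpose_mat (mat n r (\<lambda>(i, j). transpose_mat M $$ (p + i, j)))"
    by (metis transpose_transpose)
  also have "\<dots> = mat r n (\<lambda>(i, j). M $$ (i, p + j))"
    using assms by (intro eq_matI) auto
  finally show ?thesis .
qed

text \<open>The adjugate settles this over any commutative ring, polynomials included: multiplying
  \<open>M * W = 1\<close> by it gives adj M = det M . W, hence det M . (W M) = det M . 1, and det M
  cancels because det W is its inverse.\<close>

lemma inverse_matrix_commute:
  fixes M :: "'a::comm_ring_1 mat"
  assumes M: "M \<in> carrier_mat N N" and W: "W \<in> carrier_mat N N" and MW: "M * W = 1\<^sub>m N"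
  shows "W * M = 1\<^sub>m N"
proof -
  have d: "det M * det W = 1"
    using det_mult[OF M W] MW by simp
  note A = adj_mat[OF M]
  have "adj_mat M = adj_mat M * (M * W)" using A MW by simp
  also have "\<dots> = (adj_mat M * M) * W" by (rule assoc_mult_mat[symmetric, OF A(1) M W])
  also have "\<dots> = det M \<cdot>\<^sub>m W"
    unfolding A(3) using W by (simp add: mult_smult_assoc_mat[OF one_carrier_mat W])
  finally have "adj_mat M = det M \<cdot>\<^sub>m W" .
  hence "det M \<cdot>\<^sub>m (W * M) = det M \<cdot>\<^sub>m 1\<^sub>m N" 
    using A(3) mult_smult_assoc_mat[OF W M] by simp
  hence "det W \<cdot>\<^sub>m (det M \<cdot>\<^sub>m (W * M)) = det W \<cdot>\<^sub>m (det M \<cdot>\<^sub>m 1\<^sub>m N)" by simp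
  moreover have "det W \<cdot>\<^sub>m (det M \<cdot>\<^sub>m Z) = Z" for Z :: "'a mat"
  proof -
    have "det W * det M = 1" using d by (simp add: mult.commute)
    thus ?thesis by (intro eq_matI) (simp_all flip: mult.assoc)
  qed
  ultimately show ?thesis by simp
qed

section \<open>Splitting off the first block\<close>

abbreviation block_diag :: "nat \<Rightarrow> nat \<Rightarrow> 'a::comm_ring_1 mat \<Rightarrow> 'a mat \<Rightarrow> 'a mat" where
  "block_diag a b M N \<equiv> four_block_mat M (0\<^sub>m a b) (0\<^sub>m b a) N"

text \<open>\<open>E\<close> and \<open>F\<close> stand for the first block column and block row of the identity,
  \<open>J\<close> for the complementary projection; then \<open>G = J + E Q' F\<close> below is \<open>diag(Q', I)\<close>.\<close>

locale block_splitting =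
  fixes n N :: nat and E F J :: "'a::comm_ring_1 mat"
  assumes E [simp]: "E \<in> carrier_mat N n" and F [simp]: "F \<in> carrier_mat n N"
    and J [simp]: "J \<in> carrier_mat N N"
    and FE: "F * E = 1\<^sub>m n" and FJ: "F * J = 0\<^sub>m n N" and JE: "J * E = 0\<^sub>m N n"
    and JJ: "J * J = J" and EFJ: "E * F + J = 1\<^sub>m N"
begin

lemma mult_zero_one [simp]:
  "F * 0\<^sub>m N k = 0\<^sub>m n k" "J * 0\<^sub>m N k = 0\<^sub>m N k" "0\<^sub>m k n * F = 0\<^sub>m k N"
  "0\<^sub>m k N * J = 0\<^sub>m k N" "0\<^sub>m k N * E = 0\<^sub>m k n" "E * 0\<^sub>m n k = 0\<^sub>m N k"
  "1\<^sub>m n * F = F" "E * 1\<^sub>m n = E" "- 0\<^sub>m N n = (0\<^sub>m N n :: 'a mat)" "- 0\<^sub>m n N = (0\<^sub>m n N :: 'a mat)"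
  using E F J by (auto simp del: E F J)

context
  fixes Q' :: "'a mat"
  assumes Q': "Q' \<in> carrier_mat n n"
begin

lemma dims: "dim_row E = N" "dim_col E = n" "dim_row F = n" "dim_col F = N" "dim_row J = N" "dim_col J = N"
  "dim_row Q' = n" "dim_col Q' = n"
  using E F J Q' by (auto simp del: E F J)

lemma EQ [simp]: "E * Q' \<in> carrier_mat N n"
  by (rule mult_carrier_mat[OF E Q'])

lemma EQF [simp]: "E * Q' * F \<in> carrier_mat N N"
  by (rule mult_carrier_mat[OF EQ F])

definition G where "G = J + E * Q' * F"

lemma G: "G \<in> carrier_mat N N" using Q' by (simp add: G_def)

lemma FG: "F * G = Q' * F"
proof -
  have "F * G = F * J + F * (E * Q' * F)"
    unfolding G_def by (rule mult_add_distrib_mat[OF F J EQF])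
  also have "F * (E * Q' * F) = F * (E * Q') * F"
    using Q' by (intro assoc_mult_mat[symmetric, of _ n N _ n _ N]) auto
  also have "F * (E * Q') = F * E * Q'"
    using Q' by (intro assoc_mult_mat[symmetric, of _ n N _ n _ n]) auto
  finally show ?thesis using Q' by (simp add: FE FJ)
qed

lemma JG: "J * G = J"
proof -
  have "J * G = J * J + J * (E * Q' * F)"
    unfolding G_def by (rule mult_add_distrib_mat[OF J J EQF])
  also have "J * (E * Q' * F) = J * (E * Q') * F"
    using Q' by (intro assoc_mult_mat[symmetric, of _ N N _ n _ N]) auto
  also have "J * (E * Q') = J * E * Q'"
    using Q' by (intro assoc_mult_mat[symmetric, of _ N N _ n _ n]) auto
  finally show ?thesis using Q' by (simp add: JE JJ)
qed

lemma GE: "G * E = E * Q'"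
proof -
  have "G * E = J * E + E * Q' * F * E"
    unfolding G_def by (rule add_mult_distrib_mat[OF J EQF E])
  also have "E * Q' * F * E = E * Q' * (F * E)"
    using Q' by (intro assoc_mult_mat[of _ N n _ N _ n]) auto
  finally show ?thesis using Q' by (simp add: JE FE)
qed

lemma GJ: "G * J = J"
proof -
  have "G * J = J * J + E * Q' * F * J"
    unfolding G_def by (rule add_mult_distrib_mat[OF J EQF J])
  also have "E * Q' * F * J = E * Q' * (F * J)"
    using Q' by (intro assoc_mult_mat[of _ N n _ N _ N]) auto
  finally show ?thesis using Q' by (simp add: JJ FJ dims)
qed

text \<open>The larger version of the fact that [-Q', I; I, 0] has the inverse [0, I; I, Q']. The
  upper right block cancels through \<open>F * G = Q' * F\<close>. No division occurs, so the
  inverse is polynomial whenever Q' is.\<close>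

lemma step_mat_inverse:
  "four_block_mat (- Q') F E J * four_block_mat (0\<^sub>m n n) F E G = 1\<^sub>m (n + N)"
proof -
  have "four_block_mat (- Q') F E J * four_block_mat (0\<^sub>m n n) F E G
     = four_block_mat (- Q' * 0\<^sub>m n n + F * E) (- Q' * F + F * G) (E * 0\<^sub>m n n + J * E) (E * F + J * G)"
    using Q' G by (intro mult_four_block_mat[of _ n n _ N _ N _ _ n _ N]) auto
  also have "\<dots> = four_block_mat (1\<^sub>m n) (0\<^sub>m n N) (0\<^sub>m N n) (1\<^sub>m N)"
  proof (intro cong_four_block_mat)
    show "- Q' * F + F * G = 0\<^sub>m n N" unfolding FG using Q' 
      by (metis F mult_carrier_mat uminus_l_inv_mat uminus_mult_left_mat dims(3,8))
  qed (use Q' in \<open>simp_all add: FE JE JG EFJ\<close>)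
  finally show ?thesis by simp
qed

context
  fixes Q A w :: "'a mat" and x :: 'a
  assumes w: "w \<in> carrier_mat N N" and Q: "Q \<in> carrier_mat n n" and A: "A \<in> carrier_mat n n"
    and QQ: "Q' = x \<cdot>\<^sub>m Q + A"
begin

text \<open>Row elimination. The top row (Q', -F) of the pencil is minus the top row (-Q', F) of the
  Fiedler block carrying Q'. The bottom row (-w E, x - w J) is x E times (-Q', F) plus (x G - w)
  times (E, J): the terms x E Q' cancel, and x E F + x G J adds up to x.\<close>

lemma pencil_consecution_step:
  "x \<cdot>\<^sub>m block_diag n N Q (1\<^sub>m N) - block_diag n N (1\<^sub>m n) w * four_block_mat (- A) F E J
   = four_block_mat (- 1\<^sub>m n) (0\<^sub>m n N) (x \<cdot>\<^sub>m E) (1\<^sub>m N)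
     * block_diag n N (1\<^sub>m n) (x \<cdot>\<^sub>m G - w) * four_block_mat (- Q') F E J"
proof -
  have wG: "x \<cdot>\<^sub>m G - w \<in> carrier_mat N N" using w G by auto
  have "block_diag n N (1\<^sub>m n) w * four_block_mat (- A) F E J = four_block_mat (- A) F (w * E) (w * J)"
    using w A by (subst mult_four_block_mat[of _ n n _ N _ N _ _ n _ N]) (auto simp: dims intro!: cong_four_block_mat)
  moreover have "x \<cdot>\<^sub>m block_diag n N Q (1\<^sub>m N) = block_diag n N (x \<cdot>\<^sub>m Q) (x \<cdot>\<^sub>m 1\<^sub>m N)"
    using Q by (subst smult_four_block_mat[of _ n n _ N _ N]) auto
  ultimately have "x \<cdot>\<^sub>m block_diag n N Q (1\<^sub>m N) - block_diag n N (1\<^sub>m n) w * four_block_mat (- A) F E J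
     = four_block_mat Q' (- F) (- (w * E)) (x \<cdot>\<^sub>m 1\<^sub>m N - w * J)"
    using w Q A QQ by (intro eq_matI) (auto simp: dims)
  moreover have "four_block_mat (- 1\<^sub>m n) (0\<^sub>m n N) (x \<cdot>\<^sub>m E) (1\<^sub>m N) * block_diag n N (1\<^sub>m n) (x \<cdot>\<^sub>m G - w)
      = four_block_mat (- 1\<^sub>m n) (0\<^sub>m n N) (x \<cdot>\<^sub>m E) (x \<cdot>\<^sub>m G - w)"
    using wG left_mult_zero_mat[OF wG] left_mult_one_mat[OF wG]
      right_mult_one_mat[of "x \<cdot>\<^sub>m E" N n] right_mult_zero_mat[of "x \<cdot>\<^sub>m E" N n]
    by (subst mult_four_block_mat[of _ n n _ N _ N _ _ n _ N]) (auto simp: dims)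
  moreover have "four_block_mat (- 1\<^sub>m n) (0\<^sub>m n N) (x \<cdot>\<^sub>m E) (x \<cdot>\<^sub>m G - w) * four_block_mat (- Q') F E J
     = four_block_mat (- 1\<^sub>m n * (- Q') + 0\<^sub>m n N * E) (- 1\<^sub>m n * F + 0\<^sub>m n N * J)
        (x \<cdot>\<^sub>m E * (- Q') + (x \<cdot>\<^sub>m G - w) * E) (x \<cdot>\<^sub>m E * F + (x \<cdot>\<^sub>m G - w) * J)"
    using wG Q' by (intro mult_four_block_mat[of _ n n _ N _ N _ _ n _ N]) auto
  moreover have "\<dots> = four_block_mat Q' (- F) (- (w * E)) (x \<cdot>\<^sub>m 1\<^sub>m N - w * J)"
  proof (intro cong_four_block_mat)
    show "- 1\<^sub>m n * (- Q') + 0\<^sub>m n N * E = Q'" using Q' by (simp add: uminus_uminus_mat)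
    show "- 1\<^sub>m n * F + 0\<^sub>m n N * J = - F" by (simp add: dims)
    have "(x \<cdot>\<^sub>m G - w) * E = x \<cdot>\<^sub>m (E * Q') - w * E"
      using w by (simp add: minus_mult_distrib_mat[of _ N N _ _ n] mult_smult_assoc_mat[OF G E] G GE)
    moreover have "x \<cdot>\<^sub>m E * (- Q') = - (x \<cdot>\<^sub>m (E * Q'))" using Q' by (simp add: dims mult_smult_assoc_mat[OF E Q'])
    ultimately show "x \<cdot>\<^sub>m E * (- Q') + (x \<cdot>\<^sub>m G - w) * E = - (w * E)"
      using w Q' by (auto simp: dims intro!: eq_matI)
    have "(x \<cdot>\<^sub>m G - w) * J = x \<cdot>\<^sub>m J - w * J"
      using w by (simp add: minus_mult_distrib_mat[of _ N N _ _ N] mult_smult_assoc_mat[OF G J] G GJ)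
    moreover have "x \<cdot>\<^sub>m E * F = x \<cdot>\<^sub>m (E * F)" by (rule mult_smult_assoc_mat[OF E F])
    ultimately have "x \<cdot>\<^sub>m E * F + (x \<cdot>\<^sub>m G - w) * J = x \<cdot>\<^sub>m (E * F + J) - w * J"
      using w by (auto simp: dims algebra_simps intro!: eq_matI)
    thus "x \<cdot>\<^sub>m E * F + (x \<cdot>\<^sub>m G - w) * J = x \<cdot>\<^sub>m 1\<^sub>m N - w * J" by (simp add: EFJ)
  qed
  ultimately show ?thesis by simp
qed

text \<open>The mirror image: now the first block column of the pencil is minus that of the Fiedler
  block, so columns are eliminated and the triangular factor stands on the right.\<close>

lemma pencil_inversion_step:
  "x \<cdot>\<^sub>m block_diag n N Q (1\<^sub>m N) - four_block_mat (- A) F E J * block_diag n N (1\<^sub>m n) w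
   = four_block_mat (- Q') F E J * block_diag n N (1\<^sub>m n) (x \<cdot>\<^sub>m G - w)
     * four_block_mat (- 1\<^sub>m n) (x \<cdot>\<^sub>m F) (0\<^sub>m N n) (1\<^sub>m N)"
proof -
  have wG: "x \<cdot>\<^sub>m G - w \<in> carrier_mat N N" using w G by auto
  have "four_block_mat (- A) F E J * block_diag n N (1\<^sub>m n) w = four_block_mat (- A) (F * w) E (J * w)"
    using w A by (subst mult_four_block_mat[of _ n n _ N _ N _ _ n _ N]) (auto simp: dims intro!: cong_four_block_mat)
  moreover have "x \<cdot>\<^sub>m block_diag n N Q (1\<^sub>m N) = block_diag n N (x \<cdot>\<^sub>m Q) (x \<cdot>\<^sub>m 1\<^sub>m N)"
    using Q by (subst smult_four_block_mat[of _ n n _ N _ N]) auto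
  ultimately have "x \<cdot>\<^sub>m block_diag n N Q (1\<^sub>m N) - four_block_mat (- A) F E J * block_diag n N (1\<^sub>m n) w
     = four_block_mat Q' (- (F * w)) (- E) (x \<cdot>\<^sub>m 1\<^sub>m N - J * w)"
    using w Q A QQ by (intro eq_matI) (auto simp: dims)
  moreover have "four_block_mat (- Q') F E J * block_diag n N (1\<^sub>m n) (x \<cdot>\<^sub>m G - w)
      = four_block_mat (- Q') (F * (x \<cdot>\<^sub>m G - w)) E (J * (x \<cdot>\<^sub>m G - w))"
    using wG Q' mult_carrier_mat[OF F wG] mult_carrier_mat[OF J wG]
    by (subst mult_four_block_mat[of _ n n _ N _ N _ _ n _ N]) auto
  moreover have "four_block_mat (- Q') (F * (x \<cdot>\<^sub>m G - w)) E (J * (x \<cdot>\<^sub>m G - w)) 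
      * four_block_mat (- 1\<^sub>m n) (x \<cdot>\<^sub>m F) (0\<^sub>m N n) (1\<^sub>m N)
     = four_block_mat (- Q' * (- 1\<^sub>m n) + F * (x \<cdot>\<^sub>m G - w) * 0\<^sub>m N n) 
        (- Q' * (x \<cdot>\<^sub>m F) + F * (x \<cdot>\<^sub>m G - w) * 1\<^sub>m N)
        (E * (- 1\<^sub>m n) + J * (x \<cdot>\<^sub>m G - w) * 0\<^sub>m N n) (E * (x \<cdot>\<^sub>m F) + J * (x \<cdot>\<^sub>m G - w) * 1\<^sub>m N)"
    using wG Q' mult_carrier_mat[OF F wG] mult_carrier_mat[OF J wG] by (intro mult_four_block_mat[of _ n n _ N _ N _ _ n _ N]) auto
  moreover have "\<dots> = four_block_mat Q' (- (F * w)) (- E) (x \<cdot>\<^sub>m 1\<^sub>m N - J * w)"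
  proof (intro cong_four_block_mat)
    have z: "F * (x \<cdot>\<^sub>m G - w) * 0\<^sub>m N n = 0\<^sub>m n n" "J * (x \<cdot>\<^sub>m G - w) * 0\<^sub>m N n = 0\<^sub>m N n"
      "F * (x \<cdot>\<^sub>m G - w) * 1\<^sub>m N = F * (x \<cdot>\<^sub>m G - w)" "J * (x \<cdot>\<^sub>m G - w) * 1\<^sub>m N = J * (x \<cdot>\<^sub>m G - w)"
      by (rule right_mult_zero_mat right_mult_one_mat mult_carrier_mat[OF F wG] mult_carrier_mat[OF J wG])+
    show "- Q' * (- 1\<^sub>m n) + F * (x \<cdot>\<^sub>m G - w) * 0\<^sub>m N n = Q'"
      unfolding z using Q' by (simp add: uminus_uminus_mat)
    show "E * (- 1\<^sub>m n) + J * (x \<cdot>\<^sub>m G - w) * 0\<^sub>m N n = - E"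
      unfolding z by (simp add: dims)
    have "F * (x \<cdot>\<^sub>m G - w) = x \<cdot>\<^sub>m (Q' * F) - F * w"
      using w by (simp add: mult_minus_distrib_mat[of _ n N _ N] mult_smult_distrib[OF F G] G FG)
    moreover have "- Q' * (x \<cdot>\<^sub>m F) = - (x \<cdot>\<^sub>m (Q' * F))" using Q' by (simp add: dims mult_smult_distrib[OF Q' F])
    ultimately show "- Q' * (x \<cdot>\<^sub>m F) + F * (x \<cdot>\<^sub>m G - w) * 1\<^sub>m N = - (F * w)"
      unfolding z using w Q' by (auto simp: dims intro!: eq_matI)
    have "J * (x \<cdot>\<^sub>m G - w) = x \<cdot>\<^sub>m J - J * w"
      using w by (simp add: mult_minus_distrib_mat[of _ N N _ N] mult_smult_distrib[OF J G] G JG)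
    moreover have "E * (x \<cdot>\<^sub>m F) = x \<cdot>\<^sub>m (E * F)" by (rule mult_smult_distrib[OF E F])
    ultimately have "E * (x \<cdot>\<^sub>m F) + J * (x \<cdot>\<^sub>m G - w) * 1\<^sub>m N = x \<cdot>\<^sub>m (E * F + J) - J * w"
      unfolding z using w by (auto simp: dims algebra_simps intro!: eq_matI)
    thus "E * (x \<cdot>\<^sub>m F) + J * (x \<cdot>\<^sub>m G - w) * 1\<^sub>m N = x \<cdot>\<^sub>m 1\<^sub>m N - J * w" by (simp add: EFJ)
  qed
  ultimately show ?thesis by simp
qed

end
end
end

lemma block_col_mult:
  fixes M :: "'a::comm_ring_1 mat"
  assumes "M \<in> carrier_mat n c" 
  shows "transpose_mat (block_row n N p) * M
    = mat N c (\<lambda>(i, j). if p \<le> i \<and> i < p + n then M $$ (i - p, j) else 0)" (is "_ = ?R")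
proof (rule eq_matI)
  fix i j assume ij: "i < dim_row ?R" "j < dim_col ?R"
  have "(transpose_mat (block_row n N p) * M) $$ (i, j) = (\<Sum>k = 0..<n. (if i = p + k then 1 else 0) * M $$ (k, j))"
    using assms ij by (simp add: times_mat_def scalar_prod_def)
  also have "\<dots> = (\<Sum>k = 0..<n. if k = i - p then (if p \<le> i then M $$ (k, j) else 0) else 0)"
    by (rule sum.cong) auto
  also have "\<dots> = ?R $$ (i, j)" using ij by auto
  finally show "(transpose_mat (block_row n N p) * M) $$ (i, j) = ?R $$ (i, j)" .
qed (use assms in auto)

lemma mult_block_row:
  fixes M :: "'a::comm_ring_1 mat"
  assumes "M \<in> carrier_mat r n"
  shows "M * block_row n N p
    = mat r N (\<lambda>(i, j). if p \<le> j \<and> j < p + n then M $$ (i, j - p) else 0)"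
proof -
  have "transpose_mat (M * block_row n N p) = transpose_mat (block_row n N p) * transpose_mat M"
    using assms by (subst transpose_mult) auto
  also have "\<dots> = mat N r (\<lambda>(i, j). if p \<le> i \<and> i < p + n then transpose_mat M $$ (i - p, j) else 0)"
    using assms by (intro block_col_mult) auto
  finally have "M * block_row n N p = transpose_mat (mat N r (\<lambda>(i, j). if p \<le> i \<and> i < p + n then transpose_mat M $$ (i - p, j) else 0))"
    by (metis transpose_transpose)
  also have "\<dots> = mat r N (\<lambda>(i, j). if p \<le> j \<and> j < p + n then M $$ (i, j - p) else 0)"
    using assms by (intro eq_matI) auto
  finally show ?thesis .
qed

lemma block_diag_mult:
  fixes M :: "'a::comm_ring_1 mat"
  assumes "M \<in> carrier_mat a a" "M' \<in> carrier_mat a a" "X \<in> carrier_mat b b" "X' \<in> carrier_mat b b"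
  shows "block_diag a b M X * block_diag a b M' X' = block_diag a b (M * M') (X * X')"
proof -
  have "M * M' \<in> carrier_mat a a" "X * X' \<in> carrier_mat b b" using assms by (auto intro: mult_carrier_mat)
  thus ?thesis using assms
    by (subst mult_four_block_mat[of _ a a _ b _ b _ _ a _ b])
      (simp_all add: right_mult_zero_mat[of _ a a] right_mult_zero_mat[of _ b b]
        left_mult_zero_mat[of _ a a] left_mult_zero_mat[of _ b b] del: carrier_matD)
qed

lemma right_inverse_mult:
  fixes M :: "'a::comm_ring_1 mat"
  assumes "M \<in> carrier_mat N N" "M' \<in> carrier_mat N N" "W \<in> carrier_mat N N" "W' \<in> carrier_mat N N"
    and "M * M' = 1\<^sub>m N" "W * W' = 1\<^sub>m N"
  shows "(M * W) * (W' * M') = 1\<^sub>m N"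
proof -
  have "(M * W) * (W' * M') = M * (W * (W' * M'))"
    using assms by (intro assoc_mult_mat[of _ N N _ N _ N]) auto
  also have "W * (W' * M') = (W * W') * M'"
    using assms by (intro assoc_mult_mat[symmetric, of _ N N _ N _ N]) auto
  finally show ?thesis using assms by simp
qed

section \<open>Reduction of products of Fiedler blocks\<close>

definition lower_identity :: "nat \<Rightarrow> nat \<Rightarrow> 'a::comm_ring_1 mat" where
  "lower_identity n N = mat N N (\<lambda>(i, j). if i = j \<and> n \<le> i then 1 else 0)"

lemma lower_identity_block: "lower_identity n (n + N) = block_diag n N (0\<^sub>m n n) (1\<^sub>m N)"
  by (rule eq_matI) (auto simp: lower_identity_def)

lemma block_splitting_first:
  "block_splitting n (n + N) (transpose_mat (block_row n (n + N) 0)) (block_row n (n + N) 0)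
     (lower_identity n (n + N) :: 'a::comm_ring_1 mat)"
proof
  show "block_row n (n + N) 0 * transpose_mat (block_row n (n + N) 0) = (1\<^sub>m n :: 'a mat)"
    by (subst block_row_mult[of _ "n + N" n]) (auto intro!: eq_matI)
  show "block_row n (n + N) 0 * lower_identity n (n + N) = (0\<^sub>m n (n + N) :: 'a mat)"
    by (subst block_row_mult[of _ "n + N" "n + N"]) (auto simp: lower_identity_def intro!: eq_matI)
  show "lower_identity n (n + N) * transpose_mat (block_row n (n + N) 0) = (0\<^sub>m (n + N) n :: 'a mat)"
    by (subst mult_block_col[of _ "n + N" "n + N"]) (auto simp: lower_identity_def intro!: eq_matI)
  show "lower_identity n (n + N) * lower_identity n (n + N) = (lower_identity n (n + N) :: 'a mat)"
    unfolding lower_identity_block by (subst block_diag_mult) auto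
  show "transpose_mat (block_row n (n + N) 0) * block_row n (n + N) 0 + lower_identity n (n + N) = (1\<^sub>m (n + N) :: 'a mat)"
    by (subst block_col_mult[of _ _ "n + N"]) (auto simp: lower_identity_def intro!: eq_matI)
qed (auto simp: lower_identity_def)

text \<open>M_{k+1} without the identity in front, cut after its first block row: the coefficient
  sits alone in the corner, the two identities of [-X, I; I, 0] become a unit block row and column,
  and its zero block is the gap at the start of \<open>lower_identity\<close>.\<close>

definition fiedler_block :: "nat \<Rightarrow> nat \<Rightarrow> 'a::comm_ring_1 mat \<Rightarrow> 'a mat" where
  "fiedler_block n N X = four_block_mat (- X) (block_row n N 0) (transpose_mat (block_row n N 0)) (lower_identity n N)"

lemma fiedler_block_carrier [simp]:
  "X \<in> carrier_mat n n \<Longrightarrow> fiedler_block n N X \<in> carrier_mat (n + N) (n + N)"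
  by (simp add: fiedler_block_def lower_identity_def)

text \<open>The product of the Fiedler matrices with indices \<open>0, \<dots>, k\<close>, restricted to the last
  \<open>k + 1\<close> block rows; \<open>c d\<close> says that there is a consecution at \<open>d\<close>.\<close>

primrec fiedler_tail :: "nat \<Rightarrow> (nat \<Rightarrow> 'a::comm_ring_1 mat) \<Rightarrow> (nat \<Rightarrow> bool) \<Rightarrow> nat \<Rightarrow> 'a mat" where
  "fiedler_tail n A c 0 = - A 0"
| "fiedler_tail n A c (Suc k) =
    (if c k
     then block_diag n (n + k * n) (1\<^sub>m n) (fiedler_tail n A c k) * fiedler_block n (n + k * n) (A (Suc k))
     else fiedler_block n (n + k * n) (A (Suc k)) * block_diag n (n + k * n) (1\<^sub>m n) (fiedler_tail n A c k))"

lemma fiedler_tail_carrier: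
  assumes "\<And>j. j \<le> k \<Longrightarrow> A j \<in> carrier_mat n n"
  shows "fiedler_tail n A c k \<in> carrier_mat (n + k * n) (n + k * n)"
  using assms
proof (induction k)
  case (Suc k)
  have "fiedler_tail n A c k \<in> carrier_mat (n + k * n) (n + k * n)" by (rule Suc) (use Suc in auto)
  hence "block_diag n (n + k * n) (1\<^sub>m n) (fiedler_tail n A c k) \<in> carrier_mat (n + (n + k * n)) (n + (n + k * n))" by simp
  moreover have "fiedler_block n (n + k * n) (A (Suc k)) \<in> carrier_mat (n + (n + k * n)) (n + (n + k * n))"
    using Suc by simp
  ultimately have "fiedler_tail n A c (Suc k) \<in> carrier_mat (n + (n + k * n)) (n + (n + k * n))"
    by (auto intro: mult_carrier_mat)
  thus ?case by simp
qed simp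

text \<open>Horner's scheme in accumulator form: \<open>Q\<close> is the value reached so far, and
  the index falls while \<open>Q\<close> changes, exactly as in the reduction of the pencil.\<close>

primrec horner_mat :: "'a::comm_ring_1 \<Rightarrow> (nat \<Rightarrow> 'a mat) \<Rightarrow> nat \<Rightarrow> 'a mat \<Rightarrow> 'a mat" where
  "horner_mat x A 0 Q = x \<cdot>\<^sub>m Q + A 0"
| "horner_mat x A (Suc k) Q = horner_mat x A k (x \<cdot>\<^sub>m Q + A (Suc k))"

lemma horner_mat_carrier:
  "(\<And>j. j \<le> k \<Longrightarrow> A j \<in> carrier_mat n n) \<Longrightarrow> Q \<in> carrier_mat n n \<Longrightarrow> horner_mat x A k Q \<in> carrier_mat n n"
  by (induction k arbitrary: Q) auto

text \<open>Position, in blocks counted from 0, of the unit block row that the last block row of V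
  has become. A new block on top shifts every position by one, except that a Fiedler block exchanges
  the first two blocks and thereby keeps position 0. With \<open>c\<close> negated the same
  recursion serves the last block column of U.\<close>

primrec block_index :: "(nat \<Rightarrow> bool) \<Rightarrow> nat \<Rightarrow> nat" where
  "block_index c 0 = 0"
| "block_index c (Suc k) = (if c k \<and> block_index c k = 0 then 0 else Suc (block_index c k))"

lemma block_index_le: "block_index c k \<le> k"
  by (induction k) auto

lemma block_row_block_diag:
  fixes V :: "'a::comm_ring_1 mat"
  assumes V: "V \<in> carrier_mat N N" and p: "p + n \<le> N" and eq: "block_row n N p * V = block_row n N q"
  shows "block_row n (n + N) (n + p) * block_diag n N (1\<^sub>m n) V = block_row n (n + N) (n + q)"
proof -
  have "V $$ (p + i, j) = (if j = q + i then 1 else 0)" if "i < n" "j < N" for i j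
    using arg_cong[OF eq, of "\<lambda>M. M $$ (i, j)"] V p that by (simp add: block_row_mult[OF V p] del: index_mult_mat)
  thus ?thesis using V p by (subst block_row_mult[of _ "n + N" "n + N"]) (auto intro!: eq_matI)
qed

lemma block_diag_block_col:
  fixes U :: "'a::comm_ring_1 mat"
  assumes U: "U \<in> carrier_mat N N" and p: "p + n \<le> N"
    and eq: "U * transpose_mat (block_row n N p) = transpose_mat (block_row n N q)"
  shows "block_diag n N (1\<^sub>m n) U * transpose_mat (block_row n (n + N) (n + p)) = transpose_mat (block_row n (n + N) (n + q))"
proof -
  have "U $$ (i, p + j) = (if i = q + j then 1 else 0)" if "i < N" "j < n" for i j
    using arg_cong[OF eq, of "\<lambda>M. M $$ (i, j)"] U p that by (simp add: mult_block_col[OF U p] del: index_mult_mat)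
  thus ?thesis using U p by (subst mult_block_col[of _ "n + N" "n + N"]) (auto intro!: eq_matI)
qed

text \<open>Below its first block row the Fiedler block has the rows (E, J). At offset 0 the J part
  vanishes and E returns the first unit block; from offset n on, E vanishes and J acts as the
  identity. An offset strictly between would mix the two.\<close>

lemma block_row_fiedler_block:
  assumes "X \<in> carrier_mat n n" "q = 0 \<or> n \<le> q" "q + n \<le> N"
  shows "block_row n (n + N) (n + q) * fiedler_block n N X = block_row n (n + N) (if q = 0 then 0 else n + q)"
  using assms by (subst block_row_mult[of _ "n + N" "n + N"])
    (auto simp: fiedler_block_def lower_identity_def intro!: eq_matI)

lemma fiedler_block_block_col:
  assumes "X \<in> carrier_mat n n" "q = 0 \<or> n \<le> q" "q + n \<le> N"
  shows "fiedler_block n N X * transpose_mat (block_row n (n + N) (n + q)) = transpose_mat (block_row n (n + N) (if q = 0 then 0 else n + q))"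
  using assms by (subst mult_block_col[of _ "n + N" "n + N"])
    (auto simp: fiedler_block_def lower_identity_def intro!: eq_matI)

text \<open>\<open>U\<close> and \<open>V\<close> are the inverses of the reducing matrices, so that \<open>F\<close> and \<open>K\<close> are
  read off as the last block row of \<open>V\<close> and the last block column of \<open>U\<close>. The block positions
  \<open>f\<close> and \<open>g\<close> are counted from 0.\<close>

definition pencil_factorization ::
  "nat \<Rightarrow> nat \<Rightarrow> 'a::comm_ring_1 mat \<Rightarrow> 'a mat \<Rightarrow> nat \<Rightarrow> nat \<Rightarrow> bool" where
  "pencil_factorization n k L R f g \<longleftrightarrow> (\<exists>U U' V V'.
     U \<in> carrier_mat (n + k * n) (n + k * n) \<and> U' \<in> carrier_mat (n + k * n) (n + k * n) \<and>
     V \<in> carrier_mat (n + k * n) (n + k * n) \<and> V' \<in> carrier_mat (n + k * n) (n + k * n) \<and>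
     U * U' = 1\<^sub>m (n + k * n) \<and> V * V' = 1\<^sub>m (n + k * n) \<and>
     L = U * block_diag (k * n) n (1\<^sub>m (k * n)) R * V \<and>
     block_row n (n + k * n) (k * n) * V = block_row n (n + k * n) (f * n) \<and>
     U * transpose_mat (block_row n (n + k * n) (k * n)) = transpose_mat (block_row n (n + k * n) (g * n)))"

text \<open>The new outer factors are S diag(I, U) and diag(I, V) T, around diag(I, R) enlarged by
  one identity block. The last block row of diag(I, V) is already a unit block row, so it suffices
  to know where T sends this single row; likewise for S and one column.\<close>

lemma pencil_factorization_step:
  fixes L :: "'a::comm_ring_1 mat" and n k :: nat
  defines "N \<equiv> n + k * n"
  assumes fac: "pencil_factorization n k L R f g" and R: "R \<in> carrier_mat n n"
    and carr: "S \<in> carrier_mat (n + N) (n + N)" "S' \<in> carrier_mat (n + N) (n + N)"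
      "T \<in> carrier_mat (n + N) (n + N)" "T' \<in> carrier_mat (n + N) (n + N)"
    and inv: "S * S' = 1\<^sub>m (n + N)" "T * T' = 1\<^sub>m (n + N)"
    and T: "block_row n (n + N) (n + f * n) * T = block_row n (n + N) (f' * n)"
    and S: "S * transpose_mat (block_row n (n + N) (n + g * n)) = transpose_mat (block_row n (n + N) (g' * n))"
  shows "pencil_factorization n (Suc k) (S * block_diag n N (1\<^sub>m n) L * T) R f' g'"
proof -
  obtain U U' V V' where UV: "U \<in> carrier_mat N N" "U' \<in> carrier_mat N N" "V \<in> carrier_mat N N" "V' \<in> carrier_mat N N"
    and UU: "U * U' = 1\<^sub>m N" and VV: "V * V' = 1\<^sub>m N"
    and L: "L = U * block_diag (k * n) n (1\<^sub>m (k * n)) R * V"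
    and f: "block_row n N (k * n) * V = block_row n N (f * n)"
    and g: "U * transpose_mat (block_row n N (k * n)) = transpose_mat (block_row n N (g * n))"
    using fac unfolding pencil_factorization_def N_def by blast
  let ?b = "block_diag n N (1\<^sub>m n)"
  have b: "?b M \<in> carrier_mat (n + N) (n + N)" if "M \<in> carrier_mat N N" for M :: "'a mat" using that by simp
  have bb: "?b M * ?b M' = ?b (M * M')" if "M \<in> carrier_mat N N" "M' \<in> carrier_mat N N" for M M' :: "'a mat"
    using that by (simp add: block_diag_mult)
  let ?D = "block_diag (k * n) n (1\<^sub>m (k * n)) R"
  have D: "?D \<in> carrier_mat N N" 
    using four_block_carrier_mat[OF one_carrier_mat R, of "k * n"] by (simp add: N_def add.commute)
  have bD: "?b ?D = block_diag (Suc k * n) n (1\<^sub>m (Suc k * n)) R"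
    using R by (auto simp: N_def intro!: eq_matI)
  have UD: "U * ?D \<in> carrier_mat N N" using UV D by simp
  have 1: "S * ?b U \<in> carrier_mat (n + N) (n + N)" "?b U' * S' \<in> carrier_mat (n + N) (n + N)" 
    "?b V * T \<in> carrier_mat (n + N) (n + N)" "T' * ?b V' \<in> carrier_mat (n + N) (n + N)"
    by (intro mult_carrier_mat[of _ "n + N" "n + N"] b UV carr)+
  have 2: "(S * ?b U) * (?b U' * S') = 1\<^sub>m (n + N)"
    using UV UU by (intro right_inverse_mult carr inv b) (simp_all add: bb)
  have 3: "(?b V * T) * (T' * ?b V') = 1\<^sub>m (n + N)"
    using UV VV by (intro right_inverse_mult carr inv b) (simp_all add: bb)
  have "S * ?b L * T = S * (?b U * ?b ?D * ?b V) * T"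
    unfolding L using UV D UD by (simp only: bb)
  also have "S * (?b U * ?b ?D * ?b V) * T = S * ?b U * ?b ?D * (?b V * T)"
  proof -
    have *: "A1 * (A2 * A3 * A4) * A5 = A1 * A2 * A3 * (A4 * A5)"
      if "A1 \<in> carrier_mat q q" "A2 \<in> carrier_mat q q" "A3 \<in> carrier_mat q q" "A4 \<in> carrier_mat q q" "A5 \<in> carrier_mat q q"
      for A1 A2 A3 A4 A5 :: "'a mat" and q
      using that by (simp add: assoc_mult_mat[of _ q q _ q _ q])
    show ?thesis by (rule *[OF carr(1) b b b carr(3)]) (use UV D in auto)
  qed
  finally have 4: "S * ?b L * T = S * ?b U * block_diag (Suc k * n) n (1\<^sub>m (Suc k * n)) R * (?b V * T)"
    unfolding bD .
  have 5: "block_row n (n + N) (Suc k * n) * (?b V * T) = block_row n (n + N) (f' * n)"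
  proof -
    have "block_row n (n + N) (Suc k * n) * (?b V * T) = block_row n (n + N) (n + k * n) * ?b V * T"
      using b[OF UV(3)] carr by (simp add: assoc_mult_mat[of _ n "n + N" _ "n + N" _ "n + N"])
    also have "block_row n (n + N) (n + k * n) * ?b V = block_row n (n + N) (n + f * n)"
      by (rule block_row_block_diag[OF UV(3) _ f]) (simp add: N_def)
    finally show ?thesis using T by simp
  qed
  have 6: "S * ?b U * transpose_mat (block_row n (n + N) (Suc k * n)) = transpose_mat (block_row n (n + N) (g' * n))"
  proof -
    have "S * ?b U * transpose_mat (block_row n (n + N) (Suc k * n)) = S * (?b U * transpose_mat (block_row n (n + N) (n + k * n)))"
      using b[OF UV(1)] carr by (simp add: assoc_mult_mat[of _ "n + N" "n + N" _ "n + N" _ n])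
    also have "?b U * transpose_mat (block_row n (n + N) (n + k * n)) = transpose_mat (block_row n (n + N) (n + g * n))"
      by (rule block_diag_block_col[OF UV(1) _ g]) (simp add: N_def)
    finally show ?thesis using S by simp
  qed
  have NS: "n + Suc k * n = n + N" by (simp add: N_def)
  show ?thesis unfolding pencil_factorization_def NS
    using 1 2 3 4 5 6 by blast
qed

text \<open>Induction on \<open>k\<close> with \<open>Q\<close> free. Each step gives a Fiedler
  block to one side, which may keep position 0, and a triangular factor to the other, which always
  shifts by one block. These are the recursions of \<open>block_index\<close> for \<open>c\<close>
  and for its negation.\<close>

lemma fiedler_tail_factorization:
  fixes A :: "nat \<Rightarrow> 'a::comm_ring_1 mat"
  assumes "\<And>j. j \<le> k \<Longrightarrow> A j \<in> carrier_mat n n" and "Q \<in> carrier_mat n n"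
  shows "pencil_factorization n k (x \<cdot>\<^sub>m block_diag n (k * n) Q (1\<^sub>m (k * n)) - fiedler_tail n A c k)
     (horner_mat x A k Q) (block_index c k) (block_index (\<lambda>d. \<not> c d) k)"
  using assms
proof (induction k arbitrary: Q)
  case 0
  have "x \<cdot>\<^sub>m block_diag n 0 Q (1\<^sub>m 0) - - A 0 = block_diag 0 n (1\<^sub>m 0) (x \<cdot>\<^sub>m Q + A 0)"
    using 0 by (auto intro!: eq_matI)
  moreover have "block_diag 0 n (1\<^sub>m 0) (x \<cdot>\<^sub>m Q + A 0) \<in> carrier_mat n n"
    using four_block_carrier_mat[of "1\<^sub>m 0" 0 0 "x \<cdot>\<^sub>m Q + A 0" n n] 0 by simp
  ultimately show ?case unfolding pencil_factorization_def
    by (intro exI[of _ "1\<^sub>m n"]) (simp add: left_mult_one_mat[of _ n n] right_mult_one_mat[of _ n n])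
next
  case (Suc k)
  define N where "N = n + k * n"
  define Q' where "Q' = x \<cdot>\<^sub>m Q + A (Suc k)"
  let ?F = "block_row n N 0 :: 'a mat" 
  let ?w = "fiedler_tail n A c k"
  interpret block_splitting n N "transpose_mat ?F" ?F "lower_identity n N"
    unfolding N_def by (rule block_splitting_first)
  have A: "A (Suc k) \<in> carrier_mat n n" using Suc by simp
  have Q': "Q' \<in> carrier_mat n n" using Suc A by (simp add: Q'_def)
  have w: "?w \<in> carrier_mat N N" unfolding N_def using Suc by (intro fiedler_tail_carrier) auto
  \<comment> \<open>\<open>G Q'\<close> is the leading coefficient of the smaller pencil, so the
    middle factor of a reduction step is an instance of the induction hypothesis.\<close>
  have G_eq: "G Q' = block_diag n (k * n) Q' (1\<^sub>m (k * n))"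
    unfolding G_def[OF Q'] using Q'
    by (subst block_col_mult[OF Q'], subst mult_block_row[of _ N n])
      (auto simp: N_def lower_identity_def intro!: eq_matI)
  have R: "horner_mat x A k Q' \<in> carrier_mat n n" using Suc Q' by (intro horner_mat_carrier) auto
  let ?f = "block_index c k" and ?g = "block_index (\<lambda>d. \<not> c d) k"
  have IH: "pencil_factorization n k (x \<cdot>\<^sub>m G Q' - ?w) (horner_mat x A k Q') ?f ?g"
    unfolding G_eq using Suc Q' by (intro Suc.IH) auto
  have fg: "?f * n + n \<le> N" "?g * n + n \<le> N"
    unfolding N_def by (simp_all add: block_index_le)
  let ?B = "fiedler_block n N"
  let ?V' = "four_block_mat (0\<^sub>m n n) ?F (transpose_mat ?F) (G Q')"
  have B: "?B Q' \<in> carrier_mat (n + N) (n + N)" using Q' by simp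
  have V': "?V' \<in> carrier_mat (n + N) (n + N)" using G[OF Q'] by simp
  have inv: "?B Q' * ?V' = 1\<^sub>m (n + N)"
    unfolding fiedler_block_def by (rule step_mat_inverse[OF Q'])
  \<comment> \<open>For n = 0 all offsets collapse, and f n = 0 does not force f = 0; the split on
    \<open>n = 0\<close> covers this.\<close>
  have rowB: "block_row n (n + N) (n + ?f * n) * ?B Q' = block_row n (n + N) ((if ?f = 0 then 0 else Suc ?f) * n)"
    using block_row_fiedler_block[OF Q' _ fg(1)] by (cases "?f = 0"; cases "n = 0") auto
  have colB: "?B Q' * transpose_mat (block_row n (n + N) (n + ?g * n)) = transpose_mat (block_row n (n + N) ((if ?g = 0 then 0 else Suc ?g) * n))"
    using fiedler_block_block_col[OF Q' _ fg(2)] by (cases "?g = 0"; cases "n = 0") auto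
  have L: "block_diag n (Suc k * n) Q (1\<^sub>m (Suc k * n)) = block_diag n N Q (1\<^sub>m N)" by (simp add: N_def)
  show ?case
  proof (cases "c k")
    case True
    \<comment> \<open>An involution: the off-diagonal contributions - x E and x E cancel in its
      square. Its second block column is (0, I), so it leaves the shifted unit columns
      alone.\<close>
    let ?S = "four_block_mat (- 1\<^sub>m n) (0\<^sub>m n N) (x \<cdot>\<^sub>m transpose_mat ?F) (1\<^sub>m N)"
    have S: "?S \<in> carrier_mat (n + N) (n + N)" by simp
    have SS: "?S * ?S = 1\<^sub>m (n + N)"
      by (subst mult_four_block_mat[of _ n n _ N _ N _ _ n _ N]) (auto intro!: eq_matI)
    have colS: "?S * transpose_mat (block_row n (n + N) (n + ?g * n)) = transpose_mat (block_row n (n + N) (Suc ?g * n))"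
      using fg by (subst mult_block_col[OF S]) (auto intro!: eq_matI)
    have "x \<cdot>\<^sub>m block_diag n (Suc k * n) Q (1\<^sub>m (Suc k * n)) - fiedler_tail n A c (Suc k)
       = ?S * block_diag n N (1\<^sub>m n) (x \<cdot>\<^sub>m G Q' - ?w) * ?B Q'"
      unfolding L using pencil_consecution_step[OF Q' w Suc.prems(2) A Q'_def] True
      by (simp add: fiedler_block_def flip: N_def)
    moreover have "pencil_factorization n (Suc k) \<dots> (horner_mat x A k Q') (block_index c (Suc k)) (block_index (\<lambda>d. \<not> c d) (Suc k))"
      using True pencil_factorization_step[OF IH R, folded N_def, OF S S B V' SS inv rowB colS] by simp
    ultimately show ?thesis by (simp add: Q'_def)
  next
    case False
    let ?T = "four_block_mat (- 1\<^sub>m n) (x \<cdot>\<^sub>m ?F) (0\<^sub>m N n) (1\<^sub>m N)"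
    have T: "?T \<in> carrier_mat (n + N) (n + N)" by simp
    have TT: "?T * ?T = 1\<^sub>m (n + N)"
      by (subst mult_four_block_mat[of _ n n _ N _ N _ _ n _ N]) (auto intro!: eq_matI)
    have rowT: "block_row n (n + N) (n + ?f * n) * ?T = block_row n (n + N) (Suc ?f * n)"
      using fg by (subst block_row_mult[OF T]) (auto intro!: eq_matI)
    have "x \<cdot>\<^sub>m block_diag n (Suc k * n) Q (1\<^sub>m (Suc k * n)) - fiedler_tail n A c (Suc k)
       = ?B Q' * block_diag n N (1\<^sub>m n) (x \<cdot>\<^sub>m G Q' - ?w) * ?T"
      unfolding L using pencil_inversion_step[OF Q' w Suc.prems(2) A Q'_def] False
      by (simp add: fiedler_block_def flip: N_def)
    moreover have "pencil_factorization n (Suc k) \<dots> (horner_mat x A k Q') (block_index c (Suc k)) (block_index (\<lambda>d. \<not> c d) (Suc k))"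
      using False pencil_factorization_step[OF IH R, folded N_def, OF B V' T T inv TT rowT colB] by simp
    ultimately show ?thesis by (simp add: Q'_def)
  qed
qed

section \<open>Products of Fiedler matrices\<close>

lemma block_diag_empty_left [simp]: "X \<in> carrier_mat a b \<Longrightarrow> four_block_mat (1\<^sub>m 0) (0\<^sub>m 0 b) (0\<^sub>m a 0) X = X"
  by (auto intro!: eq_matI)

lemma block_diag_empty_right [simp]: "X \<in> carrier_mat a b \<Longrightarrow> four_block_mat X (0\<^sub>m a 0) (0\<^sub>m 0 b) (0\<^sub>m 0 0) = X"
  by (auto intro!: eq_matI)

lemma block_diag_one_split:
  assumes "X \<in> carrier_mat c c"
  shows "block_diag (a + b) c (1\<^sub>m (a + b)) X = block_diag a (b + c) (1\<^sub>m a) (block_diag b c (1\<^sub>m b) X)"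
  using assms by (auto intro!: eq_matI)

text \<open>Size i + 1 is the smallest in which i is not the leading index, and there M_i has no
  identity in front. A larger size only adds identity blocks at the top.\<close>

lemma fiedler_mat_diag:
  assumes A: "A i \<in> carrier_mat n n" and i: "i < m"
  shows "fiedler_mat n m A i = block_diag ((m - Suc i) * n) (Suc i * n) (1\<^sub>m ((m - Suc i) * n)) (fiedler_mat n (Suc i) A i)"
    and "fiedler_mat n (Suc i) A i \<in> carrier_mat (Suc i * n) (Suc i * n)"
proof -
  have "fiedler_mat n m A i = block_diag ((m - Suc i) * n) (Suc i * n) (1\<^sub>m ((m - Suc i) * n)) (fiedler_mat n (Suc i) A i)
    \<and> fiedler_mat n (Suc i) A i \<in> carrier_mat (Suc i * n) (Suc i * n)"
  proof (cases i)
    case 0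
    have "- A 0 \<in> carrier_mat n n" using A 0 by simp
    thus ?thesis using 0 i by (simp add: fiedler_mat_def Let_def)
  next
    case (Suc h)
    let ?F = "four_block_mat (- A i) (1\<^sub>m n) (1\<^sub>m n) (0\<^sub>m n n)"
    let ?X = "block_diag (n + n) (h * n) ?F (1\<^sub>m (h * n))"
    have F: "?F \<in> carrier_mat (n + n) (n + n)" using A by simp
    hence X: "?X \<in> carrier_mat (Suc i * n) (Suc i * n)"
      using four_block_carrier_mat[OF F one_carrier_mat[of "h * n"]] by (simp add: Suc ac_simps)
    have "diag_block_mat [?F, 1\<^sub>m (h * n)] = ?X" using A by (simp add: Let_def)
    hence D: "diag_block_mat [1\<^sub>m a, ?F, 1\<^sub>m (h * n)] = block_diag a (Suc i * n) (1\<^sub>m a) ?X" for a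
      by (simp only: diag_block_mat.simps(2)[of "1\<^sub>m a"] Let_def carrier_matD[OF X] index_one_mat)
    have e: "fiedler_mat n q A i = diag_block_mat [1\<^sub>m ((q - Suc i) * n), ?F, 1\<^sub>m (h * n)]" if "i < q" for q
      using that Suc by (simp add: fiedler_mat_def)
    have "fiedler_mat n (Suc i) A i = ?X" using X by (simp add: e[of "Suc i"] D del: diag_block_mat.simps mult_Suc)
    thus ?thesis using X by (simp only: e[OF i] D simp_thms)
  qed
  thus "fiedler_mat n m A i = block_diag ((m - Suc i) * n) (Suc i * n) (1\<^sub>m ((m - Suc i) * n)) (fiedler_mat n (Suc i) A i)"
    and "fiedler_mat n (Suc i) A i \<in> carrier_mat (Suc i * n) (Suc i * n)" by auto
qed

lemma fiedler_mat_embed: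
  assumes "A i \<in> carrier_mat n n" "i < k" "k \<le> m"
  shows "fiedler_mat n m A i = block_diag ((m - k) * n) (k * n) (1\<^sub>m ((m - k) * n)) (fiedler_mat n k A i)"
proof -
  have "i < m" using assms by simp
  note 1 = fiedler_mat_diag(1)[where A = A, OF assms(1) \<open>i < m\<close>]
    and 2 = fiedler_mat_diag[where A = A, OF assms(1,2)]
  have "(m - Suc i) * n = (m - k) * n + (k - Suc i) * n" "(k - Suc i) * n + Suc i * n = k * n"
    using assms by (simp_all flip: add_mult_distrib del: mult_Suc)
  thus ?thesis
    unfolding 1 2(1)
    using block_diag_one_split[OF 2(2), of "(m - k) * n" "(k - Suc i) * n"] by simp
qed

lemma fiedler_mat_carrier:
  assumes "\<And>j. j \<le> m \<Longrightarrow> A j \<in> carrier_mat n n" "1 \<le> m" "i \<le> m"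
  shows "fiedler_mat n m A i \<in> carrier_mat (m * n) (m * n)"
proof (cases "i < m")
  case True
  have A: "A i \<in> carrier_mat n n" using assms by simp
  have "(m - Suc i) * n + Suc i * n = m * n"
    using True by (simp flip: add_mult_distrib del: mult_Suc)
  thus ?thesis
    using four_block_carrier_mat[OF one_carrier_mat fiedler_mat_diag(2)[where A = A, OF A True], of "(m - Suc i) * n"]
    unfolding fiedler_mat_diag(1)[where A = A, OF A True] by metis
next
  case False
  hence "fiedler_mat n m A i = diag_block_mat [A m, 1\<^sub>m ((m - 1) * n)]"
    using assms by (simp add: fiedler_mat_def)
  moreover have "A m \<in> carrier_mat n n" using assms by simp
  moreover have "n + (m - 1) * n = m * n" using assms(2) by (cases m) auto
  ultimately show ?thesis by (intro carrier_matI) (simp_all add: Let_def)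
qed

lemma fiedler_mat_lower_identity:
  assumes A: "A (Suc k) \<in> carrier_mat n n" and k: "Suc k < m"
  shows "\<exists>Y \<in> carrier_mat ((m - k) * n) ((m - k) * n). fiedler_mat n m A (Suc k) = block_diag ((m - k) * n) (k * n) Y (1\<^sub>m (k * n))"
proof -
  let ?F = "four_block_mat (- A (Suc k)) (1\<^sub>m n) (1\<^sub>m n) (0\<^sub>m n n)"
  let ?Y = "diag_block_mat [1\<^sub>m ((m - Suc k - 1) * n), ?F]"
  obtain a where m: "m = Suc (Suc k + a)" using less_imp_Suc_add[OF k] by auto
  have "(m - k) * n = (m - Suc k - 1) * n + (n + n)" by (simp add: m)
  hence Y: "?Y \<in> carrier_mat ((m - k) * n) ((m - k) * n)"
    using A by (auto simp: Let_def)
  have "fiedler_mat n m A (Suc k) = diag_block_mat ([1\<^sub>m ((m - Suc k - 1) * n), ?F] @ [1\<^sub>m (k * n)])"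
    using k by (simp add: fiedler_mat_def)
  also have "\<dots> = block_diag ((m - k) * n) (k * n) ?Y (1\<^sub>m (k * n))"
    unfolding diag_block_mat_last using Y by (simp only: Let_def carrier_matD[OF Y] index_one_mat)
  finally show ?thesis using Y by blast
qed

text \<open>M_{k+1} is the identity on the last k block rows, and M_i with i < k is the identity on
  all the others, so the two act on complementary diagonal blocks.\<close>

lemma fiedler_mat_commute:
  assumes "\<And>j. j \<le> m \<Longrightarrow> A j \<in> carrier_mat n n" "i < k" "Suc k < m"
  shows "fiedler_mat n m A i * fiedler_mat n m A (Suc k) = fiedler_mat n m A (Suc k) * fiedler_mat n m A i"
proof -
  obtain Y where Y: "Y \<in> carrier_mat ((m - k) * n) ((m - k) * n)"
    "fiedler_mat n m A (Suc k) = block_diag ((m - k) * n) (k * n) Y (1\<^sub>m (k * n))"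
    using fiedler_mat_lower_identity[where A = A, OF assms(1)[of "Suc k"] assms(3)] assms(3) by fastforce
  have Z: "fiedler_mat n m A i = block_diag ((m - k) * n) (k * n) (1\<^sub>m ((m - k) * n)) (fiedler_mat n k A i)"
    using assms by (intro fiedler_mat_embed) auto
  have F: "fiedler_mat n k A i \<in> carrier_mat (k * n) (k * n)"
    using assms by (intro fiedler_mat_carrier) auto
  show ?thesis unfolding Y(2) Z block_diag_mult[OF one_carrier_mat Y(1) F one_carrier_mat]
      block_diag_mult[OF Y(1) one_carrier_mat one_carrier_mat F]
    by (simp only: left_mult_one_mat[OF Y(1)] right_mult_one_mat[OF Y(1)] left_mult_one_mat[OF F] right_mult_one_mat[OF F])
qed

text \<open>Two ways to cut one matrix: around the 2 x 2 block containing the coefficient, as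
  Fiedler matrices are given, or after the first block row, as the reduction step consumes
  it.\<close>

lemma fiedler_block_alt:
  assumes "X \<in> carrier_mat n n"
  shows "block_diag (n + n) N (four_block_mat (- X) (1\<^sub>m n) (1\<^sub>m n) (0\<^sub>m n n)) (1\<^sub>m N) = fiedler_block n (n + N) X"
    (is "?L = ?R")
proof (rule eq_matI)
  fix i j assume ij: "i < dim_row ?R" "j < dim_col ?R"
  show "?L $$ (i, j) = ?R $$ (i, j)"
    using ij assms by (cases "i < n"; cases "j < n") (auto simp: fiedler_block_def lower_identity_def)
qed (use assms in \<open>auto simp: fiedler_block_def lower_identity_def\<close>)

lemma fiedler_mat_last:
  assumes "A (Suc k) \<in> carrier_mat n n"
  shows "fiedler_mat n (Suc (Suc k)) A (Suc k) = fiedler_block n (n + k * n) (A (Suc k))"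
proof -
  let ?F = "four_block_mat (- A (Suc k)) (1\<^sub>m n) (1\<^sub>m n) (0\<^sub>m n n)"
  let ?X = "block_diag (n + n) (k * n) ?F (1\<^sub>m (k * n))"
  have "diag_block_mat [?F, 1\<^sub>m (k * n)] = ?X" using assms by (simp add: Let_def)
  moreover have "?X \<in> carrier_mat (n + n + k * n) (n + n + k * n)" using assms by simp
  ultimately have "fiedler_mat n (Suc (Suc k)) A (Suc k) = ?X"
    by (simp add: fiedler_mat_def diag_block_mat.simps(2)[of "1\<^sub>m 0"] Let_def del: diag_block_mat.simps)
  thus ?thesis using fiedler_block_alt[OF assms] by simp
qed

section \<open>Ordered products of Fiedler matrices\<close>

abbreviation mat_prod :: "nat \<Rightarrow> 'a::comm_ring_1 mat list \<Rightarrow> 'a mat" where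
  "mat_prod N Ms \<equiv> foldr (*) Ms (1\<^sub>m N)"

lemma mat_prod_carrier:
  "set Ms \<subseteq> carrier_mat N N \<Longrightarrow> mat_prod N Ms \<in> carrier_mat N N"
  by (induction Ms) auto

lemma mat_prod_append:
  assumes "set Ms \<subseteq> carrier_mat N N" "set Ms' \<subseteq> carrier_mat N N"
  shows "mat_prod N (Ms @ Ms') = mat_prod N Ms * mat_prod N Ms'"
  using assms
proof (induction Ms)
  case Nil
  thus ?case using mat_prod_carrier[of Ms' N] by simp
next
  case (Cons M Ms)
  thus ?case using mat_prod_carrier[of Ms' N] mat_prod_carrier[of Ms N]
    by (simp add: assoc_mult_mat[of _ N N _ N _ N])
qed

lemma mat_prod_commute:
  assumes "set Ms \<subseteq> carrier_mat N N" "W \<in> carrier_mat N N" "\<And>M. M \<in> set Ms \<Longrightarrow> M * W = W * M"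
  shows "mat_prod N Ms * W = W * mat_prod N Ms"
  using assms
proof (induction Ms)
  case (Cons M Ms)
  have M: "M \<in> carrier_mat N N" and P: "mat_prod N Ms \<in> carrier_mat N N" and W: "W \<in> carrier_mat N N"
    using Cons.prems mat_prod_carrier[of Ms N] by auto
  have "mat_prod N (M # Ms) * W = M * (mat_prod N Ms * W)"
    using M P W by (simp add: assoc_mult_mat[of _ N N _ N _ N])
  also have "\<dots> = M * (W * mat_prod N Ms)" using Cons by simp
  also have "\<dots> = (M * W) * mat_prod N Ms" 
    using M P W by (simp add: assoc_mult_mat[of _ N N _ N _ N])
  also have "M * W = W * M" using Cons by simp
  finally show ?case using M P W by (simp add: assoc_mult_mat[of _ N N _ N _ N])
qed simp

text \<open>Any list of the indices 0, ..., k in increasing order of \<sigma> is allowed, since the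
  induction removes k + 1 from the middle of the list. Among the remaining indices only k may fail
  to commute with k + 1, so M_{k+1} can be moved past the side that does not contain k.\<close>

lemma mat_prod_fiedler:
  fixes A :: "nat \<Rightarrow> complex mat" and \<sigma> :: "nat \<Rightarrow> nat"
  assumes A: "\<And>j. j \<le> m \<Longrightarrow> A j \<in> carrier_mat n n" and k: "k < m"
    and "is": "sorted_wrt (\<lambda>a b. \<sigma> a < \<sigma> b) is" "set is = {..k}"
  shows "mat_prod (m * n) (map (fiedler_mat n m A) is)
    = block_diag ((m - Suc k) * n) (n + k * n) (1\<^sub>m ((m - Suc k) * n)) (fiedler_tail n A (consecution \<sigma>) k)"
  using k "is"
proof (induction k arbitrary: "is")
  case 0
  have M: "fiedler_mat n m A 0 \<in> carrier_mat (m * n) (m * n)" using 0 A by (intro fiedler_mat_carrier) auto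
  have "distinct is" using 0(2) by (induction "is") auto
  hence "length is = 1" using 0(3) distinct_card[of "is"] by simp
  then obtain a where "is = [a]" by (auto simp: length_Suc_conv)
  hence "is = [0]" using 0(3) by simp
  thus ?case using 0(1) A[of 0] right_mult_one_mat[OF M] by (simp add: fiedler_mat_def Let_def)
next
  case (Suc k)
  let ?M = "fiedler_mat n m A" and ?T = "fiedler_tail n A (consecution \<sigma>) k"
  let ?N = "m * n"
  obtain as bs where split: "is = as @ Suc k # bs"
    using split_list[of "Suc k" "is"] Suc.prems(3) by auto
  have dist: "distinct is" using Suc.prems(2) by (induction "is") auto
  have sorted: "sorted_wrt (\<lambda>a b. \<sigma> a < \<sigma> b) (as @ bs)" 
    and ord: "\<And>a. a \<in> set as \<Longrightarrow> \<sigma> a < \<sigma> (Suc k)" "\<And>b. b \<in> set bs \<Longrightarrow> \<sigma> (Suc k) < \<sigma> b"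
    using Suc.prems(2) unfolding split by (auto simp: sorted_wrt_append)
  have set: "set (as @ bs) = {..k}"
  proof -
    have "set (as @ bs) = set is - {Suc k}" using dist unfolding split by auto
    thus ?thesis using Suc.prems(3) by (simp add: atMost_Suc)
  qed
  have MC: "?M i \<in> carrier_mat ?N ?N" if "i \<le> m" for i
    using that Suc.prems A by (intro fiedler_mat_carrier) auto
  have as: "set (map ?M as) \<subseteq> carrier_mat ?N ?N" and bs: "set (map ?M bs) \<subseteq> carrier_mat ?N ?N"
  proof -
    have "?M i \<in> carrier_mat ?N ?N" if "i \<in> set (as @ bs)" for i
      using that Suc.prems(1) unfolding set by (intro MC) simp
    thus "set (map ?M as) \<subseteq> carrier_mat ?N ?N" "set (map ?M bs) \<subseteq> carrier_mat ?N ?N"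
      unfolding set_append set_map by blast+
  qed
  have S: "?M (Suc k) \<in> carrier_mat ?N ?N" using Suc.prems by (intro MC) auto
  let ?P = "\<lambda>l. mat_prod ?N (map ?M l)"
  have P: "?P as \<in> carrier_mat ?N ?N" "?P bs \<in> carrier_mat ?N ?N" using as bs by (auto intro!: mat_prod_carrier simp del: set_map)
  have prod: "?P is = ?P as * (?M (Suc k) * ?P bs)"
    unfolding split using mat_prod_append[OF as, of "map ?M (Suc k # bs)"] S bs by auto
  have IH: "?P (as @ bs) = block_diag ((m - Suc k) * n) (n + k * n) (1\<^sub>m ((m - Suc k) * n)) ?T"
    using Suc.IH[OF _ sorted set] Suc.prems by simp
  have comm: "?M i * ?M (Suc k) = ?M (Suc k) * ?M i" if "i < k" for i
    using that Suc.prems A by (intro fiedler_mat_commute) auto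
  have T: "?T \<in> carrier_mat (n + k * n) (n + k * n)" using A Suc.prems by (intro fiedler_tail_carrier) auto
  let ?r = "m - Suc (Suc k)"
  \<comment> \<open>The shorter product has one identity block more in its prefix; that block
    becomes the identity in front of the tail which the recursion of \<open>fiedler_tail\<close>
    asks for.\<close>
  have r: "m - Suc k = Suc ?r" using Suc.prems by auto
  have IH': "?P (as @ bs) = block_diag (?r * n) (n + (n + k * n)) (1\<^sub>m (?r * n)) (block_diag n (n + k * n) (1\<^sub>m n) ?T)"
    unfolding IH r mult_Suc add.commute[of n "?r * n"] by (rule block_diag_one_split[OF T])
  have emb: "?M (Suc k) = block_diag (?r * n) (n + (n + k * n)) (1\<^sub>m (?r * n)) (fiedler_block n (n + k * n) (A (Suc k)))"
    using fiedler_mat_embed[where A = A and i = "Suc k" and n = n and k = "Suc (Suc k)" and m = m]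
      fiedler_mat_last[where A = A and n = n and k = k] A[of "Suc k"] Suc.prems(1) by simp
  have B: "fiedler_block n (n + k * n) (A (Suc k)) \<in> carrier_mat (n + (n + k * n)) (n + (n + k * n))"
    using A Suc.prems by simp
  have D: "block_diag n (n + k * n) (1\<^sub>m n) ?T \<in> carrier_mat (n + (n + k * n)) (n + (n + k * n))"
    using T by simp
  have less: "i < k" if "i \<le> k" "i \<noteq> k" for i using that by simp
  show ?case
  proof (cases "consecution \<sigma> k")
    case True
    \<comment> \<open>A consecution at k puts k to the left of k + 1, so M_{k+1} passes everything
      on its right.\<close>
    hence "k \<notin> set bs" using ord(2)[of k] by (auto simp: consecution_def)
    hence "?P bs * ?M (Suc k) = ?M (Suc k) * ?P bs"
      using set bs S by (intro mat_prod_commute) (auto intro!: comm less)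
    hence "?P is = ?P (as @ bs) * ?M (Suc k)"
      using prod mat_prod_append[OF as bs] P S by (simp add: assoc_mult_mat[of _ ?N ?N _ ?N _ ?N])
    thus ?thesis unfolding IH' emb using B D True by (simp add: block_diag_mult)
  next
    case False
    \<comment> \<open>Now k stands to the right of k + 1, and M_{k+1} moves to the front
      instead.\<close>
    hence "k \<notin> set as" using ord(1)[of k] by (auto simp: consecution_def)
    hence "?P as * ?M (Suc k) = ?M (Suc k) * ?P as"
      using set as S by (intro mat_prod_commute) (auto intro!: comm less)
    hence "?P is = ?M (Suc k) * ?P (as @ bs)"
      using prod mat_prod_append[OF as bs] assoc_mult_mat[OF P(1) S P(2)] assoc_mult_mat[OF S P]
      by (simp only: map_append)
    thus ?thesis unfolding IH' emb using B D False by (simp add: block_diag_mult)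
  qed
qed

text \<open>The inverse of \<sigma>, read at 1, ..., m, lists all indices in increasing order of
  \<sigma>. For k = m - 1 the identity prefix has size 0 and the product is the tail itself.\<close>

lemma fiedler_prod_eq_tail:
  assumes A: "\<And>j. j \<le> m \<Longrightarrow> A j \<in> carrier_mat n n" and m: "m \<ge> 1"
    and \<sigma>: "bij_betw \<sigma> {0..<m} {1..m}"
  shows "fiedler_prod n m A \<sigma> = fiedler_tail n A (consecution \<sigma>) (m - 1)"
proof -
  let ?\<tau> = "inv_into {0..<m} \<sigma>"
  let ?is = "map ?\<tau> [1..<m+1]"
  have \<tau>: "\<sigma> (?\<tau> k) = k" if "k \<in> {1..m}" for k
    using \<sigma> that by (intro f_inv_into_f) (auto simp: bij_betw_def)
  have "sorted_wrt (\<lambda>a b. ?\<tau> a = ?\<tau> a \<and> \<sigma> (?\<tau> a) < \<sigma> (?\<tau> b)) [1..<m+1]"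
    by (rule sorted_wrt_mono_rel[OF _ sorted_wrt_upt]) (auto simp: \<tau>)
  hence s: "sorted_wrt (\<lambda>a b. \<sigma> a < \<sigma> b) ?is" by (simp add: sorted_wrt_map)
  have "?\<tau> ` {1..m} = {0..<m}" using bij_betw_inv_into[OF \<sigma>] by (simp add: bij_betw_def)
  moreover have "set ?is = ?\<tau> ` {1..m}" by (simp only: set_map set_upt) (auto simp: less_Suc_eq_le)
  ultimately have set: "set ?is = {..m - 1}" using m by auto
  have "fiedler_prod n m A \<sigma> = mat_prod (m * n) (map (fiedler_mat n m A) ?is)"
    by (simp add: fiedler_prod_def comp_def)
  also have "\<dots> = block_diag ((m - Suc (m - 1)) * n) (n + (m - 1) * n) (1\<^sub>m ((m - Suc (m - 1)) * n)) (fiedler_tail n A (consecution \<sigma>) (m - 1))"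
    using m by (intro mat_prod_fiedler[OF A _ s set]) auto
  also have "\<dots> = fiedler_tail n A (consecution \<sigma>) (m - 1)"
  proof -
    have "fiedler_tail n A (consecution \<sigma>) (m - 1) \<in> carrier_mat (n + (m - 1) * n) (n + (m - 1) * n)"
      using A by (intro fiedler_tail_carrier) auto
    thus ?thesis using m by (auto intro!: eq_matI)
  qed
  finally show ?thesis .
qed

section \<open>Polynomials in the derivative\<close>

lemma nth_vderiv_0 [simp]: "nth_vderiv 0 f = f"
  by (simp add: nth_vderiv_def)

lemma nth_vderiv_Suc: "nth_vderiv (Suc k) f = (\<lambda>t. vector_derivative (nth_vderiv k f) (at t))"
  by (simp add: nth_vderiv_def)

lemma nth_vderiv_Suc': "nth_vderiv (Suc k) f = nth_vderiv k (\<lambda>t. vector_derivative f (at t))"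
  by (simp add: nth_vderiv_def funpow_swap1[of "\<lambda>f t. vector_derivative f (at t)"])

lemma smooth_fun_vderiv: "smooth_fun f \<Longrightarrow> (nth_vderiv k f has_vector_derivative nth_vderiv (Suc k) f t) (at t)"
  by (simp add: smooth_fun_def nth_vderiv_Suc vector_derivative_works)

text \<open>\<open>vector_derivative\<close> is meaningful only where the function is
  differentiable, so termwise differentiation at every order rests on smoothness.\<close>

lemma nth_vderiv_add:
  assumes "smooth_fun f" "smooth_fun g"
  shows "nth_vderiv k (\<lambda>t. f t + g t) = (\<lambda>t. nth_vderiv k f t + nth_vderiv k g t)"
proof (induction k)
  case (Suc k)
  show ?case unfolding nth_vderiv_Suc[of k "\<lambda>t. f t + g t"] Suc
    by (rule ext, rule vector_derivative_at) (intro derivative_intros smooth_fun_vderiv assms)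
qed simp

lemma nth_vderiv_cmult:
  assumes "smooth_fun f"
  shows "nth_vderiv k (\<lambda>t. a * f t) = (\<lambda>t. a * nth_vderiv k f t)"
proof (induction k)
  case (Suc k)
  show ?case unfolding nth_vderiv_Suc[of k "\<lambda>t. a * f t"] Suc
    by (rule ext, rule vector_derivative_at) (intro has_vector_derivative_mult_right smooth_fun_vderiv assms)
qed simp

lemma smooth_fun_add: "smooth_fun f \<Longrightarrow> smooth_fun g \<Longrightarrow> smooth_fun (\<lambda>t. f t + g t)"
  unfolding smooth_fun_def[of "\<lambda>t. f t + g t"]
  by (auto simp: nth_vderiv_add smooth_fun_def)

lemma smooth_fun_cmult: "smooth_fun f \<Longrightarrow> smooth_fun (\<lambda>t. a * f t)"
  unfolding smooth_fun_def[of "\<lambda>t. a * f t"]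
  by (auto simp: nth_vderiv_cmult smooth_fun_def intro!: derivative_intros)

lemma nth_vderiv_zero: "nth_vderiv k (\<lambda>t. 0) = (\<lambda>t. 0)"
  by (induction k) (simp_all add: nth_vderiv_Suc)

lemma smooth_fun_zero: "smooth_fun (\<lambda>t. 0)"
  by (simp add: smooth_fun_def nth_vderiv_zero)

lemma smooth_fun_deriv: "smooth_fun f \<Longrightarrow> smooth_fun (\<lambda>t. vector_derivative f (at t))"
  unfolding smooth_fun_def nth_vderiv_Suc'[symmetric] by blast

lemma smooth_fun_sum: "(\<And>j. j \<in> S \<Longrightarrow> smooth_fun (f j)) \<Longrightarrow> smooth_fun (\<lambda>t. \<Sum>j\<in>S. f j t)"
  by (induction S rule: infinite_finite_induct) (auto simp: smooth_fun_zero smooth_fun_add)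

section \<open>Scalar operators p(d/dt)\<close>

definition poly_op :: "complex poly \<Rightarrow> (real \<Rightarrow> complex) \<Rightarrow> real \<Rightarrow> complex" where
  "poly_op p f t = (\<Sum>k\<le>degree p. coeff p k * nth_vderiv k f t)"

lemma poly_op_bound: "degree p \<le> d \<Longrightarrow> poly_op p f t = (\<Sum>k\<le>d. coeff p k * nth_vderiv k f t)"
  unfolding poly_op_def by (rule sum.mono_neutral_left) (auto simp: coeff_eq_0)

lemma poly_op_0 [simp]: "poly_op 0 f t = 0"
  by (simp add: poly_op_def)

text \<open>Multiplying a polynomial by \<lambda> amounts to differentiating the signal first. This
  opens the way to inductions over polynomials that avoid degrees.\<close>

lemma poly_op_pCons: "poly_op (pCons a p) f t = a * f t + poly_op p (\<lambda>t. vector_derivative f (at t)) t"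
proof -
  have "poly_op (pCons a p) f t = (\<Sum>k\<le>Suc (degree p). coeff (pCons a p) k * nth_vderiv k f t)"
    by (rule poly_op_bound) (rule degree_pCons_le)
  also have "\<dots> = a * f t + (\<Sum>k\<le>degree p. coeff p k * nth_vderiv (Suc k) f t)"
    by (subst sum.atMost_Suc_shift) simp
  finally show ?thesis by (simp add: poly_op_def nth_vderiv_Suc')
qed

lemma poly_op_const [simp]: "poly_op [:a:] f t = a * f t"
  by (simp add: poly_op_pCons)

lemma poly_op_add: "poly_op (p + q) f t = poly_op p f t + poly_op q f t"
proof -
  let ?d = "max (degree p) (degree q)"
  have "poly_op (p + q) f t = (\<Sum>k\<le>?d. coeff (p + q) k * nth_vderiv k f t)"
    by (rule poly_op_bound) (rule degree_add_le_max)
  thus ?thesis using poly_op_bound[of p ?d f t] poly_op_bound[of q ?d f t]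
    by (simp add: sum.distrib distrib_right)
qed

lemma poly_op_smult: "poly_op (smult a p) f t = a * poly_op p f t"
  using poly_op_bound[of "smult a p" "degree p" f t]
  by (simp add: degree_smult_le poly_op_def sum_distrib_left mult.assoc)

lemma poly_op_minus: "poly_op (- p) f t = - poly_op p f t"
  by (simp add: poly_op_def sum_negf)

lemma poly_op_sum_left: "poly_op (\<Sum>j\<in>S. p j) f t = (\<Sum>j\<in>S. poly_op (p j) f t)"
  by (induction S rule: infinite_finite_induct) (auto simp: poly_op_add)

lemma smooth_fun_poly_op: "smooth_fun f \<Longrightarrow> smooth_fun (poly_op p f)"
proof (induction p arbitrary: f)
  case (pCons a p)
  show ?case using smooth_fun_add[OF smooth_fun_cmult[OF pCons.prems] pCons.IH[OF smooth_fun_deriv[OF pCons.prems]]]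
    by (simp add: poly_op_pCons[abs_def])
qed (simp add: smooth_fun_zero poly_op_def[abs_def])

lemma poly_op_add_right: "smooth_fun f \<Longrightarrow> smooth_fun g \<Longrightarrow> poly_op p (\<lambda>t. f t + g t) t = poly_op p f t + poly_op p g t"
  by (simp add: poly_op_def nth_vderiv_add distrib_left sum.distrib)

lemma poly_op_zero_right [simp]: "poly_op p (\<lambda>t. 0) t = 0"
  by (simp add: poly_op_def nth_vderiv_zero)

lemma poly_op_sum_right:
  "(\<And>j. j \<in> S \<Longrightarrow> smooth_fun (f j)) \<Longrightarrow> poly_op p (\<lambda>t. \<Sum>j\<in>S. f j t) t = (\<Sum>j\<in>S. poly_op p (f j) t)"
  by (induction S rule: infinite_finite_induct) (auto simp: poly_op_add_right smooth_fun_sum)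

lemma vector_derivative_poly_op:
  "smooth_fun f \<Longrightarrow> vector_derivative (poly_op p f) (at t) = poly_op p (\<lambda>t. vector_derivative f (at t)) t"
  unfolding poly_op_def[abs_def] nth_vderiv_Suc'[symmetric]
  by (rule vector_derivative_at)
    (intro has_vector_derivative_sum has_vector_derivative_mult_right smooth_fun_vderiv)

text \<open>Multiplication in C[\<lambda>] becomes composition. In the induction, d/dt has to be
  exchanged with q(d/dt), which smoothness of \<open>f\<close> permits.\<close>

lemma poly_op_mult: "smooth_fun f \<Longrightarrow> poly_op (p * q) f t = poly_op p (poly_op q f) t"
proof (induction p arbitrary: f t)
  case (pCons a p)
  have "poly_op (pCons a p * q) f t = a * poly_op q f t + poly_op p (poly_op q (\<lambda>t. vector_derivative f (at t))) t"
    by (simp add: mult_pCons_left poly_op_add poly_op_smult poly_op_pCons pCons smooth_fun_deriv)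
  also have "poly_op q (\<lambda>t. vector_derivative f (at t)) = (\<lambda>t. vector_derivative (poly_op q f) (at t))"
    using pCons.prems by (simp add: vector_derivative_poly_op fun_eq_iff)
  finally show ?case by (simp add: poly_op_pCons)
qed simp

section \<open>Matrix operators M(d/dt)\<close>

lemma diff_op_eq: "diff_op M x t = vec (dim_row M) (\<lambda>i. \<Sum>j<dim_col M. poly_op (M $$ (i, j)) (\<lambda>s. x s $ j) t)"
  by (simp add: diff_op_def poly_op_def)

lemma dim_diff_op [simp]: "dim_vec (diff_op M x t) = dim_row M"
  by (simp add: diff_op_eq)

lemma smooth_signal_diff_op:
  assumes M: "M \<in> carrier_mat a b" and x: "smooth_signal b x"
  shows "smooth_signal a (diff_op M x)"
  unfolding smooth_signal_def
proof (intro conjI allI impI)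
  show "diff_op M x t \<in> carrier_vec a" for t using M by (intro carrier_vecI) simp
  fix i assume i: "i < a"
  have e: "(\<lambda>t. diff_op M x t $ i) = (\<lambda>t. \<Sum>j<b. poly_op (M $$ (i, j)) (\<lambda>s. x s $ j) t)"
    using M i by (simp add: diff_op_eq)
  show "smooth_fun (\<lambda>t. diff_op M x t $ i)"
    unfolding e using x by (intro smooth_fun_sum smooth_fun_poly_op) (simp add: smooth_signal_def)
qed

text \<open>The bridge from matrix identities over C[\<lambda>] to differential equations. Entrywise
  it is \<open>poly_op_mult\<close>; the two sums are exchanged, and each scalar operator is
  additive on smooth signals.\<close>

lemma diff_op_mult:
  assumes M: "M \<in> carrier_mat a b" and W: "W \<in> carrier_mat b c" and x: "smooth_signal c x"
  shows "diff_op (M * W) x t = diff_op M (diff_op W x) t"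
proof (rule eq_vecI)
  fix i assume "i < dim_vec (diff_op M (diff_op W x) t)"
  hence i: "i < a" using M by simp
  have sm: "smooth_fun (\<lambda>s. x s $ j)" if "j < c" for j using x that by (simp add: smooth_signal_def)
  have e: "(M * W) $$ (i, j) = (\<Sum>k<b. M $$ (i, k) * W $$ (k, j))" if "j < c" for j
    using M W i that by (simp add: times_mat_def scalar_prod_def atLeast0LessThan)
  have "diff_op (M * W) x t $ i = (\<Sum>j<c. poly_op ((M * W) $$ (i, j)) (\<lambda>s. x s $ j) t)"
    using M W i by (simp add: diff_op_eq)
  also have "\<dots> = (\<Sum>j<c. \<Sum>k<b. poly_op (M $$ (i, k)) (poly_op (W $$ (k, j)) (\<lambda>s. x s $ j)) t)"
    by (simp add: e poly_op_sum_left poly_op_mult sm)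
  also have "\<dots> = (\<Sum>k<b. \<Sum>j<c. poly_op (M $$ (i, k)) (poly_op (W $$ (k, j)) (\<lambda>s. x s $ j)) t)"
    by (rule sum.swap)
  also have "\<dots> = (\<Sum>k<b. poly_op (M $$ (i, k)) (\<lambda>s. \<Sum>j<c. poly_op (W $$ (k, j)) (\<lambda>s. x s $ j) s) t)"
    by (intro sum.cong refl poly_op_sum_right[symmetric]) (simp add: smooth_fun_poly_op sm)
  also have "\<dots> = diff_op M (diff_op W x) t $ i"
    using M W i by (simp add: diff_op_eq)
  finally show "diff_op (M * W) x t $ i = diff_op M (diff_op W x) t $ i" .
qed (use M in simp)

lemma diff_op_const_mat:
  assumes "M \<in> carrier_mat a b" "x t \<in> carrier_vec b"
  shows "diff_op (const_mat M) x t = M *\<^sub>v x t"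
  using assms by (auto simp: diff_op_eq const_mat_def scalar_prod_def atLeast0LessThan intro!: eq_vecI)

lemma diff_op_add:
  assumes "M \<in> carrier_mat a b" "W \<in> carrier_mat a b"
  shows "diff_op (M + W) x t = diff_op M x t + diff_op W x t"
  using assms by (auto simp: diff_op_eq poly_op_add sum.distrib intro!: eq_vecI)

lemma diff_op_uminus: "diff_op (- M) x t = - diff_op M x t"
  by (auto simp: diff_op_eq poly_op_minus sum_negf intro!: eq_vecI)

lemma diff_op_minus:
  assumes "M \<in> carrier_mat a b" "W \<in> carrier_mat a b"
  shows "diff_op (M - W) x t = diff_op M x t - diff_op W x t"
proof -
  have "M - W = M + - W" using assms by (auto intro!: eq_matI)
  thus ?thesis using assms by (simp add: diff_op_add[of M a b] diff_op_uminus) (auto intro!: eq_vecI)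
qed

lemma diff_op_four_block:
  assumes "A \<in> carrier_mat a b" "B \<in> carrier_mat a c" "C \<in> carrier_mat d b" "D \<in> carrier_mat d c"
    and "\<And>s. x s \<in> carrier_vec b" "\<And>s. u s \<in> carrier_vec c"
  shows "diff_op (four_block_mat A B C D) (\<lambda>s. x s @\<^sub>v u s) t
    = (diff_op A x t + diff_op B u t) @\<^sub>v (diff_op C x t + diff_op D u t)"
proof (rule eq_vecI)
  have dim: "dim_vec (x s) = b" "dim_vec (u s) = c" for s using assms(5,6)[of s] by auto
  fix i assume "i < dim_vec ((diff_op A x t + diff_op B u t) @\<^sub>v (diff_op C x t + diff_op D u t))"
  hence i: "i < a + d" using assms by simp
  have split: "(\<Sum>j<b + c. f j) = (\<Sum>j<b. f j) + (\<Sum>j<c. f (b + j))" for f :: "nat \<Rightarrow> complex"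
    by (induction c) (simp_all add: add.assoc)
  let ?w = "\<lambda>j s. (x s @\<^sub>v u s) $ j"
  have w: "?w j = (\<lambda>s. x s $ j)" if "j < b" for j using dim that by (auto simp: fun_eq_iff)
  have w': "?w (b + j) = (\<lambda>s. u s $ j)" if "j < c" for j using dim that by (auto simp: fun_eq_iff)
  let ?M = "four_block_mat A B C D"
  have "diff_op ?M (\<lambda>s. x s @\<^sub>v u s) t $ i = (\<Sum>j<b. poly_op (?M $$ (i, j)) (?w j) t) + (\<Sum>j<c. poly_op (?M $$ (i, b + j)) (?w (b + j)) t)"
    using assms(1-4) i by (simp add: diff_op_eq split)
  also have "\<dots> = (\<Sum>j<b. poly_op (?M $$ (i, j)) (\<lambda>s. x s $ j) t) + (\<Sum>j<c. poly_op (?M $$ (i, b + j)) (\<lambda>s. u s $ j) t)"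
    by (intro arg_cong2[where f = "(+)"] sum.cong refl) (simp_all only: lessThan_iff w w')
  also have "\<dots> = ((diff_op A x t + diff_op B u t) @\<^sub>v (diff_op C x t + diff_op D u t)) $ i"
    using assms(1-4) i by (simp add: diff_op_eq)
  finally show "diff_op ?M (\<lambda>s. x s @\<^sub>v u s) t $ i = ((diff_op A x t + diff_op B u t) @\<^sub>v (diff_op C x t + diff_op D u t)) $ i" .
qed (use assms(1-4) in simp)

section \<open>Reduction of the Fiedler pencil\<close>

lemma dim_const_mat [simp]: "dim_row (const_mat M) = dim_row M" "dim_col (const_mat M) = dim_col M"
  by (simp_all add: const_mat_def)

lemma index_const_mat [simp]: "i < dim_row M \<Longrightarrow> j < dim_col M \<Longrightarrow> const_mat M $$ (i, j) = [:M $$ (i, j):]"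
  by (simp add: const_mat_def)

lemma const_mat_carrier [simp]: "M \<in> carrier_mat a b \<Longrightarrow> const_mat M \<in> carrier_mat a b"
  by (simp add: const_mat_def)

lemma const_mat_mult:
  assumes "M \<in> carrier_mat a b" "W \<in> carrier_mat b c"
  shows "const_mat (M * W) = const_mat M * const_mat W"
proof (rule eq_matI)
  fix i j assume "i < dim_row (const_mat M * const_mat W)" "j < dim_col (const_mat M * const_mat W)"
  thus "const_mat (M * W) $$ (i, j) = (const_mat M * const_mat W) $$ (i, j)"
    using assms by (simp add: times_mat_def scalar_prod_def sum_to_poly mult.commute)
qed simp_all

lemma const_mat_one [simp]: "const_mat (1\<^sub>m n) = 1\<^sub>m n"
  by (rule eq_matI) (auto simp: one_pCons)

lemma const_mat_zero [simp]: "const_mat (0\<^sub>m a b) = 0\<^sub>m a b"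
  by (rule eq_matI) auto

lemma const_mat_uminus: "const_mat (- M) = - const_mat M"
  by (rule eq_matI) auto

lemma const_mat_transpose: "const_mat (transpose_mat M) = transpose_mat (const_mat M)"
  by (rule eq_matI) auto

lemma const_mat_block_row [simp]: "const_mat (block_row n N p) = block_row n N p"
  by (rule eq_matI) (auto simp: one_pCons)

lemma const_mat_four_block:
  assumes "A \<in> carrier_mat a b" "B \<in> carrier_mat a c" "C \<in> carrier_mat d b" "D \<in> carrier_mat d c"
  shows "const_mat (four_block_mat A B C D) = four_block_mat (const_mat A) (const_mat B) (const_mat C) (const_mat D)"
  unfolding const_mat_def by (rule map_four_block_mat[OF assms])

lemma lower_identity_carrier [simp]: "lower_identity n N \<in> carrier_mat N N"
  by (simp add: lower_identity_def)

lemma const_mat_lower_identity [simp]: "const_mat (lower_identity n N) = lower_identity n N"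
  by (rule eq_matI) (auto simp: one_pCons lower_identity_def)

lemma const_mat_fiedler_block:
  "X \<in> carrier_mat n n \<Longrightarrow> const_mat (fiedler_block n N X) = fiedler_block n N (const_mat X)"
  unfolding fiedler_block_def
  by (subst const_mat_four_block[of _ n n _ N _ N])
    (auto simp: const_mat_uminus const_mat_transpose)

text \<open>Carries the product of complex Fiedler matrices into the reduction over C[\<lambda>]:
  the recursion is the same, with each coefficient replaced by its constant polynomial
  matrix.\<close>

lemma const_mat_fiedler_tail:
  assumes "\<And>j. j \<le> k \<Longrightarrow> A j \<in> carrier_mat n n"
  shows "const_mat (fiedler_tail n A c k) = fiedler_tail n (\<lambda>j. const_mat (A j)) c k"
  using assms
proof (induction k)
  case (Suc k)
  let ?N = "n + k * n"
  have T: "fiedler_tail n A c k \<in> carrier_mat ?N ?N" using Suc.prems by (intro fiedler_tail_carrier) auto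
  have B: "fiedler_block n ?N (A (Suc k)) \<in> carrier_mat (n + ?N) (n + ?N)" using Suc.prems by simp
  have D: "block_diag n ?N (1\<^sub>m n) (fiedler_tail n A c k) \<in> carrier_mat (n + ?N) (n + ?N)" using T by simp
  have "const_mat (block_diag n ?N (1\<^sub>m n) (fiedler_tail n A c k)) = block_diag n ?N (1\<^sub>m n) (fiedler_tail n (\<lambda>j. const_mat (A j)) c k)"
    using T Suc by (subst const_mat_four_block[of _ n n _ ?N _ ?N]) auto
  moreover have "const_mat (fiedler_block n ?N (A (Suc k))) = fiedler_block n ?N (const_mat (A (Suc k)))"
    using Suc.prems by (intro const_mat_fiedler_block) auto
  ultimately show ?case
    using const_mat_mult[OF B D] const_mat_mult[OF D B] by simp
qed (simp add: const_mat_uminus)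

section \<open>Kronecker products with unit vectors as block rows and columns\<close>

lemma index_unit_col: "i < m \<Longrightarrow> 1 \<le> p \<Longrightarrow> p \<le> m \<Longrightarrow> unit_col m p $$ (i, 0) = (if i = p - 1 then 1 else 0)"
  by (simp add: unit_col_def mat_of_cols_index)

lemma dim_unit_col [simp]: "dim_row (unit_col m p) = m" "dim_col (unit_col m p) = 1"
  by (simp_all add: unit_col_def)

lemma div_eq_iff_interval: "j div n = q \<longleftrightarrow> q * n \<le> j \<and> j < q * n + n" if "0 < n" for j n q :: nat
proof
  assume "j div n = q"
  thus "q * n \<le> j \<and> j < q * n + n"
    using div_mult_mod_eq[of j n] mod_less_divisor[OF that, of j] by (metis le_add1 nat_add_left_cancel_less)
next
  assume "q * n \<le> j \<and> j < q * n + n"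
  thus "j div n = q" by (intro div_nat_eqI) (auto simp: mult.commute)
qed

text \<open>Row i of the Kronecker product lies in block \<open>i div n\<close>, and only block p -
  1 is filled: unit vectors are counted from 1, offsets from 0.\<close>

lemma unit_col_kron:
  assumes B: "B \<in> carrier_mat n r" and p: "1 \<le> p" "p \<le> m"
  shows "unit_col m p \<otimes>\<^sub>K B = transpose_mat (block_row n (m * n) ((p - 1) * n)) * B"
  unfolding block_col_mult[OF B]
proof (rule eq_matI)
  fix i j
  assume "i < dim_row (mat (m * n) r (\<lambda>(i, j). if (p - 1) * n \<le> i \<and> i < (p - 1) * n + n then B $$ (i - (p - 1) * n, j) else 0))"
    "j < dim_col (mat (m * n) r (\<lambda>(i, j). if (p - 1) * n \<le> i \<and> i < (p - 1) * n + n then B $$ (i - (p - 1) * n, j) else 0))"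
  hence ij: "i < m * n" "j < r" by auto
  \<comment> \<open>A row index below \<open>m * n\<close> exists, so division by n is
    meaningful.\<close>
  hence n: "0 < n" by (cases n) auto
  have "i div n < m" using ij by (simp add: less_mult_imp_div_less)
  moreover have "i mod n = i - (i div n) * n" by (simp add: minus_div_mult_eq_mod)
  ultimately show "(unit_col m p \<otimes>\<^sub>K B) $$ (i, j) = mat (m * n) r (\<lambda>(i, j). if (p - 1) * n \<le> i \<and> i < (p - 1) * n + n then B $$ (i - (p - 1) * n, j) else 0) $$ (i, j)"
    using ij B p div_eq_iff_interval[OF n, of i "p - 1"] by (auto simp: kron_mat_def index_unit_col)
qed (use B in \<open>auto simp: kron_mat_def\<close>)

lemma kron_transpose: "transpose_mat (M \<otimes>\<^sub>K W) = transpose_mat M \<otimes>\<^sub>K transpose_mat W"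
proof -
  have "i mod b < b" if "i < a * b" for i a b :: nat using that by (cases b) auto
  thus ?thesis by (intro eq_matI) (auto simp: kron_mat_def less_mult_imp_div_less)
qed

lemma unit_row_kron:
  assumes C: "C \<in> carrier_mat r n" and p: "1 \<le> p" "p \<le> m"
  shows "unit_row m p \<otimes>\<^sub>K C = C * block_row n (m * n) ((p - 1) * n)"
proof -
  have "transpose_mat (unit_row m p \<otimes>\<^sub>K C) = transpose_mat (block_row n (m * n) ((p - 1) * n)) * transpose_mat C"
    unfolding kron_transpose transpose_transpose using C p by (intro unit_col_kron) auto
  also have "\<dots> = transpose_mat (C * block_row n (m * n) ((p - 1) * n))"
    using C by (intro transpose_mult[symmetric]) auto
  finally show ?thesis by (metis transpose_transpose)
qed

lemma unit_row_kron_one: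
  "1 \<le> p \<Longrightarrow> p \<le> m \<Longrightarrow> unit_row m p \<otimes>\<^sub>K 1\<^sub>m n = block_row n (m * n) ((p - 1) * n)"
  by (subst unit_row_kron[of _ n n]) (auto intro: left_mult_one_mat)

text \<open>One product suffices to evaluate the definite description in \<open>mat_inv\<close>:
  \<open>W\<close> is then a two-sided inverse, and any competitor Z satisfies Z = W M Z =
  W.\<close>

lemma mat_inv_eqI:
  assumes M: "M \<in> carrier_mat N N" and W: "W \<in> carrier_mat N N" and MW: "M * W = 1\<^sub>m N"
  shows "mat_inv M = W"
  unfolding mat_inv_def
proof (rule the_equality)
  have WM: "W * M = 1\<^sub>m N" by (rule inverse_matrix_commute[OF M W MW])
  show "W \<in> carrier_mat (dim_row M) (dim_row M) \<and> inverts_mat M W \<and> inverts_mat W M"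
    using M W MW WM by (simp add: inverts_mat_def)
  fix Z assume "Z \<in> carrier_mat (dim_row M) (dim_row M) \<and> inverts_mat M Z \<and> inverts_mat Z M"
  hence Z: "Z \<in> carrier_mat N N" "M * Z = 1\<^sub>m N" using M by (auto simp: inverts_mat_def)
  have "Z = W * M * Z" using Z WM by simp
  also have "\<dots> = W * (M * Z)" by (rule assoc_mult_mat[OF W M Z(1)])
  finally show "Z = W" using W Z by simp
qed

text \<open>det M divides 1 in C[\<lambda>], and the units there are the nonzero constants.\<close>

lemma unimodular_matI:
  assumes M: "M \<in> carrier_mat N N" and W: "W \<in> carrier_mat N N" and MW: "M * W = 1\<^sub>m N"
  shows "unimodular_mat M"
proof -
  have "det M * det W = 1" using det_mult[OF M W] MW by simp
  hence "is_unit (det M)" by (metis dvd_triv_left)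
  then obtain c where "det M = [:c:]" "c dvd 1" using is_unit_poly_iff by blast
  thus ?thesis using M unfolding unimodular_mat_def by auto
qed

section \<open>Block positions read off from the CISS\<close>

lemma block_index_eq_0: "(\<And>d. d < a \<Longrightarrow> c d) \<Longrightarrow> block_index c a = 0"
  by (induction a) auto

text \<open>The position stays 0 during the initial run of length a, becomes 1 at the first failure,
  and from then on grows with every step because it is no longer 0.\<close>

lemma block_index_initial:
  assumes "\<And>d. d < a \<Longrightarrow> c d" "a \<le> k" "a < k \<Longrightarrow> \<not> c a"
  shows "block_index c k = k - a"
  using assms(2,3)
proof (induction k rule: dec_induct)
  case base
  thus ?case using block_index_eq_0[of a c] assms(1) by simp
next
  case (step k)
  thus ?case by (cases "a = k") auto
qed

text \<open>Both positions are governed by initial runs. That of consecutions has length c1; that of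
  non-consecutions is empty if c1 > 0 and has length i1 otherwise. Positivity of the inner entries
  of the CISS makes each run end exactly there.\<close>

lemma CISS_block_index:
  assumes "is_CISS m \<sigma> ((c1, i1) # cs)"
  shows "block_index (consecution \<sigma>) (m - 1) = m - 1 - c1"
    and "block_index (\<lambda>d. \<not> consecution \<sigma> d) (m - 1) = (if c1 > 0 then m - 1 else m - 1 - i1)"
    and "c1 + i1 \<le> m - 1"
proof -
  let ?l = "(c1, i1) # cs"
  note def = assms[unfolded is_CISS_def]
  have len: "ciss_start ?l (length ?l) = m - 1" by (rule conjunct1[OF conjunct2[OF def]])
  have all: "case ?l ! k of (c, i) \<Rightarrow>
        (\<forall>d \<in> {ciss_start ?l k ..< ciss_start ?l k + c}. consecution \<sigma> d) \<and>
        (\<forall>d \<in> {ciss_start ?l k + c ..< ciss_start ?l k + c + i}. inversion \<sigma> d) \<and>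
        (0 < k \<longrightarrow> 0 < c) \<and> (k + 1 < length ?l \<longrightarrow> 0 < i)" if "k < length ?l" for k
    by (rule mp[OF spec[OF conjunct2[OF conjunct2[OF def]]] that])
  show le: "c1 + i1 \<le> m - 1" using len by (simp add: ciss_start_def)
  have cons: "consecution \<sigma> d" if "d < c1" for d
    using all[of 0] that by (auto simp: ciss_start_def)
  have inv: "\<not> consecution \<sigma> d" if "c1 \<le> d" "d < c1 + i1" for d
  proof -
    have "inversion \<sigma> d" using all[of 0] that by (auto simp: ciss_start_def)
    thus ?thesis by (simp add: inversion_def consecution_def)
  qed
  \<comment> \<open>Either further pairs follow and i1 is positive by definition, or the sequence
    ends here and c1 + i1 = m - 1.\<close>
  have i1: "0 < i1" if "c1 < m - 1"
    using all[of 0] len that by (cases cs) (auto simp: ciss_start_def)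
  show "block_index (consecution \<sigma>) (m - 1) = m - 1 - c1"
    using cons inv i1 le by (intro block_index_initial) auto
  \<comment> \<open>If the sequence goes on, its next entry c2 is positive and its consecutions
    start exactly at c1 + i1.\<close>
  have next_cons: "consecution \<sigma> (c1 + i1)" if "c1 + i1 < m - 1"
  proof (cases cs)
    case Nil
    thus ?thesis using len that by (simp add: ciss_start_def)
  next
    case (Cons p cs')
    thus ?thesis using all[of 1] by (cases p) (auto simp: ciss_start_def)
  qed
  show "block_index (\<lambda>d. \<not> consecution \<sigma> d) (m - 1) = (if c1 > 0 then m - 1 else m - 1 - i1)"
  proof (cases "c1 > 0")
    case True
    thus ?thesis using cons[of 0] block_index_initial[of 0 "\<lambda>d. \<not> consecution \<sigma> d" "m - 1"] by simp
  next
    case False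
    thus ?thesis using inv next_cons le block_index_initial[of i1 "\<lambda>d. \<not> consecution \<sigma> d" "m - 1"] by simp
  qed
qed

lemma horner_mat_index:
  assumes "\<And>j. j \<le> k \<Longrightarrow> A j \<in> carrier_mat n n" "Q \<in> carrier_mat n n" "a < n" "b < n"
  shows "horner_mat x (\<lambda>j. const_mat (A j)) k Q $$ (a, b)
     = x ^ Suc k * Q $$ (a, b) + (\<Sum>j\<le>k. x ^ j * [:A j $$ (a, b):])"
  using assms
proof (induction k arbitrary: Q)
  case (Suc k)
  have A: "A (Suc k) \<in> carrier_mat n n" using Suc.prems by simp
  have "horner_mat x (\<lambda>j. const_mat (A j)) (Suc k) Q $$ (a, b)
    = x ^ Suc k * (x \<cdot>\<^sub>m Q + const_mat (A (Suc k))) $$ (a, b) + (\<Sum>j\<le>k. x ^ j * [:A j $$ (a, b):])"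
    using Suc.prems A by (simp only: horner_mat.simps) (intro Suc.IH, auto)
  thus ?case using Suc.prems A by (simp add: algebra_simps)
qed auto

text \<open>The accumulator starts at the leading coefficient, so running the scheme through the
  indices k, ..., 0 evaluates all of P.\<close>

lemma horner_mat_matrix_poly:
  assumes "\<And>j. j \<le> Suc k \<Longrightarrow> A j \<in> carrier_mat n n"
  shows "horner_mat [:0, 1:] (\<lambda>j. const_mat (A j)) k (const_mat (A (Suc k))) = matrix_poly n (Suc k) A"
proof (rule eq_matI)
  have A: "A (Suc k) \<in> carrier_mat n n" using assms by simp
  have m: "[:0, 1:] ^ j * [:z:] = monom z j" for j and z :: complex
    by (simp add: monom_altdef)
  have "horner_mat [:0, 1:] (\<lambda>j. const_mat (A j)) k (const_mat (A (Suc k))) \<in> carrier_mat n n"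
    using assms by (intro horner_mat_carrier) auto
  thus "dim_row (horner_mat [:0, 1:] (\<lambda>j. const_mat (A j)) k (const_mat (A (Suc k)))) = dim_row (matrix_poly n (Suc k) A)"
    "dim_col (horner_mat [:0, 1:] (\<lambda>j. const_mat (A j)) k (const_mat (A (Suc k)))) = dim_col (matrix_poly n (Suc k) A)"
    by (auto simp: matrix_poly_def)
  fix i j assume "i < dim_row (matrix_poly n (Suc k) A)" "j < dim_col (matrix_poly n (Suc k) A)"
  hence ij: "i < n" "j < n" by (auto simp: matrix_poly_def)
  have "horner_mat [:0, 1:] (\<lambda>j. const_mat (A j)) k (const_mat (A (Suc k))) $$ (i, j)
    = [:0, 1:] ^ Suc k * const_mat (A (Suc k)) $$ (i, j) + (\<Sum>l\<le>k. [:0, 1:] ^ l * [:A l $$ (i, j):])"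
    using assms ij by (intro horner_mat_index) auto
  also have "\<dots> = matrix_poly n (Suc k) A $$ (i, j)"
    using ij A by (simp only: carrier_matD[OF A] index_const_mat m) (simp add: matrix_poly_def add.commute)
  finally show "horner_mat [:0, 1:] (\<lambda>j. const_mat (A j)) k (const_mat (A (Suc k))) $$ (i, j) = matrix_poly n (Suc k) A $$ (i, j)" .
qed

lemma fiedler_pencil_factorization:
  assumes m: "m \<ge> 1" and A: "\<And>j. j \<le> m \<Longrightarrow> A j \<in> carrier_mat n n"
    and \<sigma>: "bij_betw \<sigma> {0..<m} {1..m}" and ciss: "is_CISS m \<sigma> ((c1, i1) # cs)"
  shows "pencil_factorization n (m - 1) (fiedler_pencil n m A \<sigma>) (matrix_poly n m A)
     (m - 1 - c1) (if c1 > 0 then m - 1 else m - 1 - i1)"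
proof -
  obtain k where k: "m = Suc k" using m by (cases m) auto
  have Ak: "A (Suc k) \<in> carrier_mat n n" using A k by simp
  have M: "const_mat (fiedler_mat n m A m) = block_diag n (k * n) (const_mat (A (Suc k))) (1\<^sub>m (k * n))"
  proof -
    have "fiedler_mat n m A m = diag_block_mat [A (Suc k), 1\<^sub>m (k * n)]" by (simp add: fiedler_mat_def k)
    also have "\<dots> = block_diag n (k * n) (A (Suc k)) (1\<^sub>m (k * n))" using Ak by (simp add: Let_def)
    finally show ?thesis using Ak by (simp add: const_mat_four_block[of _ n n _ "k * n" _ "k * n"])
  qed
  have p: "fiedler_prod n m A \<sigma> = fiedler_tail n A (consecution \<sigma>) k"
    using fiedler_prod_eq_tail[where A = A, OF A m \<sigma>] k by simp
  have "const_mat (fiedler_prod n m A \<sigma>) = fiedler_tail n (\<lambda>j. const_mat (A j)) (consecution \<sigma>) k"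
    unfolding p using A k by (intro const_mat_fiedler_tail) auto
  hence L: "fiedler_pencil n m A \<sigma> = [:0, 1:] \<cdot>\<^sub>m block_diag n (k * n) (const_mat (A (Suc k))) (1\<^sub>m (k * n))
      - fiedler_tail n (\<lambda>j. const_mat (A j)) (consecution \<sigma>) k"
    by (simp add: fiedler_pencil_def M)
  have R: "matrix_poly n m A = horner_mat [:0, 1:] (\<lambda>j. const_mat (A j)) k (const_mat (A (Suc k)))"
    unfolding k using A k by (intro horner_mat_matrix_poly[symmetric]) auto
  show ?thesis
    unfolding L R CISS_block_index(1,2)[OF ciss, symmetric] unfolding k diff_Suc_1
    using A k by (intro fiedler_tail_factorization) auto
qed

text \<open>The reducing matrices are the inverses U' and V' of the outer factors. Hence
  \<open>mat_inv\<close> returns U and V themselves, so F is the last block row of V, and K, by the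
  transpose in its definition, is the transposed last block column of U.\<close>

lemma fiedler_reduction_exists:
  assumes m: "m \<ge> 1" and A: "\<And>j. j \<le> m \<Longrightarrow> A j \<in> carrier_mat n n"
    and \<sigma>: "bij_betw \<sigma> {0..<m} {1..m}" and ciss: "is_CISS m \<sigma> ((c1, i1) # cs)"
  shows "\<exists>U V. fiedler_reduction n m A \<sigma> c1 i1 U V"
proof -
  define g where "g = (if c1 > 0 then m - 1 else m - 1 - i1)"
  obtain k where k: "m = Suc k" using m by (cases m) auto
  have N: "n + k * n = m * n" by (simp add: k)
  define D where "D = block_diag (k * n) n (1\<^sub>m (k * n)) (matrix_poly n m A)"
  obtain U U' V V' where UV: "U \<in> carrier_mat (m * n) (m * n)" "U' \<in> carrier_mat (m * n) (m * n)"
      "V \<in> carrier_mat (m * n) (m * n)" "V' \<in> carrier_mat (m * n) (m * n)"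
    and inv: "U * U' = 1\<^sub>m (m * n)" "V * V' = 1\<^sub>m (m * n)"
    and L: "fiedler_pencil n m A \<sigma> = U * D * V"
    and F: "block_row n (m * n) (k * n) * V = block_row n (m * n) ((m - 1 - c1) * n)"
    and K: "U * transpose_mat (block_row n (m * n) (k * n)) = transpose_mat (block_row n (m * n) (g * n))"
    using fiedler_pencil_factorization[where A = A, OF assms] unfolding pencil_factorization_def g_def[symmetric] D_def
    unfolding k diff_Suc_1 N[unfolded k] by blast
  have inv': "U' * U = 1\<^sub>m (m * n)" "V' * V = 1\<^sub>m (m * n)"
    using UV inv by (auto intro: inverse_matrix_commute)
  have P: "matrix_poly n m A \<in> carrier_mat n n" by (simp add: matrix_poly_def)
  have D: "D \<in> carrier_mat (m * n) (m * n)"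
    using four_block_carrier_mat[OF one_carrier_mat[of "k * n"] P] by (simp add: D_def k add.commute)
  \<comment> \<open>Since c1 and i1 are at most m - 1, the unit vectors with indices m - c1 and m -
    i1 exist.\<close>
  have bounds: "1 \<le> m - c1" "1 \<le> m - i1" using CISS_block_index(3)[OF ciss] m by auto
  have "U' * (U * D * V) * V' = (U' * U) * D * (V * V')"
    using UV D by (simp add: assoc_mult_mat[of _ "m * n" "m * n" _ "m * n" _ "m * n"])
  also have "\<dots> = D" using D inv inv' by simp
  also have "D = diag_block_mat [1\<^sub>m ((m - 1) * n), matrix_poly n m A]"
    using P by (simp add: D_def k Let_def)
  finally have "U' * fiedler_pencil n m A \<sigma> * V' = diag_block_mat [1\<^sub>m ((m - 1) * n), matrix_poly n m A]"
    unfolding L .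
  moreover have "fiedler_F n m V' = const_mat (unit_row m (m - c1) \<otimes>\<^sub>K 1\<^sub>m n)"
    using F bounds unfolding fiedler_F_def mat_inv_eqI[OF UV(4,3) inv'(2)]
    by (simp add: unit_row_kron_one m k)
  moreover have "fiedler_K n m U' = const_mat ((if c1 > 0 then unit_row m m else unit_row m (m - i1)) \<otimes>\<^sub>K 1\<^sub>m n)"
  proof -
    have "fiedler_K n m U' = block_row n (m * n) (k * n) * transpose_mat U"
      unfolding fiedler_K_def mat_inv_eqI[OF UV(2,1) inv'(1)] using m by (simp add: unit_row_kron_one k)
    also have "\<dots> = transpose_mat (U * transpose_mat (block_row n (m * n) (k * n)))"
      using UV(1) by (subst transpose_mult[of _ "m * n" "m * n"]) auto
    also have "\<dots> = block_row n (m * n) (g * n)" by (simp add: K)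
    finally show ?thesis using m bounds by (simp add: unit_row_kron_one g_def)
  qed
  ultimately have "fiedler_reduction n m A \<sigma> c1 i1 U' V'"
    unfolding fiedler_reduction_def
    using UV unimodular_matI[OF UV(2,1) inv'(1)] unimodular_matI[OF UV(4,3) inv'(2)] by blast
  thus ?thesis by blast
qed

section \<open>Solutions and strict system equivalence\<close>

lemma pencil_factorizationE:
  fixes L :: "'a::comm_ring_1 mat"
  assumes "pencil_factorization n k L R f g" and R: "R \<in> carrier_mat n n"
  obtains U U' V V' where
    "U \<in> carrier_mat (n + k * n) (n + k * n)" "U' \<in> carrier_mat (n + k * n) (n + k * n)"
    "V \<in> carrier_mat (n + k * n) (n + k * n)" "V' \<in> carrier_mat (n + k * n) (n + k * n)"
    "U * U' = 1\<^sub>m (n + k * n)" "U' * U = 1\<^sub>m (n + k * n)" "V * V' = 1\<^sub>m (n + k * n)" "V' * V = 1\<^sub>m (n + k * n)"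
    "block_diag (k * n) n (1\<^sub>m (k * n)) R \<in> carrier_mat (n + k * n) (n + k * n)"
    "L = U * block_diag (k * n) n (1\<^sub>m (k * n)) R * V"
    "block_row n (n + k * n) (k * n) * V = block_row n (n + k * n) (f * n)"
    "U * transpose_mat (block_row n (n + k * n) (k * n)) = transpose_mat (block_row n (n + k * n) (g * n))"
proof -
  obtain U U' V V' where UV: "U \<in> carrier_mat (n + k * n) (n + k * n)" "U' \<in> carrier_mat (n + k * n) (n + k * n)"
    "V \<in> carrier_mat (n + k * n) (n + k * n)" "V' \<in> carrier_mat (n + k * n) (n + k * n)"
    and inv: "U * U' = 1\<^sub>m (n + k * n)" "V * V' = 1\<^sub>m (n + k * n)"
    and rest: "L = U * block_diag (k * n) n (1\<^sub>m (k * n)) R * V"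
    "block_row n (n + k * n) (k * n) * V = block_row n (n + k * n) (f * n)"
    "U * transpose_mat (block_row n (n + k * n) (k * n)) = transpose_mat (block_row n (n + k * n) (g * n))"
    using assms(1) unfolding pencil_factorization_def by blast
  have "block_diag (k * n) n (1\<^sub>m (k * n)) R \<in> carrier_mat (n + k * n) (n + k * n)"
    using four_block_carrier_mat[OF one_carrier_mat[of "k * n"] R] by (simp add: add.commute)
  thus thesis
    using that[OF UV inv(1) inverse_matrix_commute[OF UV(1,2) inv(1)] inv(2) inverse_matrix_commute[OF UV(3,4) inv(2)] _ rest]
    by blast
qed

text \<open>Let E be the last block row of the identity and W = E U'. As E diag(I, R) = R E,
  cancelling U in W L leaves R E V; in the second identity it leaves E E^T, which is the
  identity.\<close>

lemma pencil_factorization_left: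
  fixes L :: "'a::comm_ring_1 mat"
  assumes fac: "pencil_factorization n k L R f g" and R: "R \<in> carrier_mat n n"
  obtains W where "W \<in> carrier_mat n (n + k * n)" "W * L = R * block_row n (n + k * n) (f * n)"
    "W * transpose_mat (block_row n (n + k * n) (g * n)) = 1\<^sub>m n"
proof -
  let ?N = "n + k * n"
  let ?E = "block_row n ?N (k * n) :: 'a mat" and ?D = "block_diag (k * n) n (1\<^sub>m (k * n)) R"
  obtain U U' V where UV: "U \<in> carrier_mat ?N ?N" "U' \<in> carrier_mat ?N ?N" "V \<in> carrier_mat ?N ?N"
    and inv: "U' * U = 1\<^sub>m ?N"
    and D: "?D \<in> carrier_mat ?N ?N" and L: "L = U * ?D * V"
    and F: "?E * V = block_row n ?N (f * n)" and K: "U * transpose_mat ?E = transpose_mat (block_row n ?N (g * n))"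
    using fac R by (rule pencil_factorizationE)
  have E: "?E \<in> carrier_mat n ?N" and Et: "transpose_mat ?E \<in> carrier_mat ?N n" by auto
  have ED: "?E * ?D = R * ?E"
    unfolding mult_block_row[OF R] using R by (subst block_row_mult[OF D]) (auto intro!: eq_matI)
  have EU: "?E * U' \<in> carrier_mat n ?N" by (rule mult_carrier_mat[OF E UV(2)])
  have EUU: "?E * U' * U = ?E" using assoc_mult_mat[OF E UV(2,1)] inv E by simp
  have "?E * U' * L = ?E * U' * (U * ?D) * V"
    unfolding L by (rule assoc_mult_mat[symmetric, OF EU mult_carrier_mat[OF UV(1) D] UV(3)])
  also have "?E * U' * (U * ?D) = R * ?E"
    unfolding assoc_mult_mat[symmetric, OF EU UV(1) D] EUU ED ..
  also have "R * ?E * V = R * (?E * V)" by (rule assoc_mult_mat[OF R E UV(3)])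
  finally have 1: "?E * U' * L = R * block_row n ?N (f * n)" by (simp add: F)
  have "?E * U' * (U * transpose_mat ?E) = ?E * transpose_mat ?E"
    unfolding assoc_mult_mat[symmetric, OF EU UV(1) Et] EUU ..
  also have "\<dots> = 1\<^sub>m n" by (subst block_row_mult[OF Et]) (auto intro!: eq_matI)
  finally have 2: "?E * U' * transpose_mat (block_row n ?N (g * n)) = 1\<^sub>m n" by (simp add: K)
  show thesis using that[OF _ 1 2] mult_carrier_mat[OF E UV(2)] by blast
qed

section \<open>Equations of the associated state-space system\<close>

lemma smooth_signal_carrier: "smooth_signal N X \<Longrightarrow> X t \<in> carrier_vec N"
  by (simp add: smooth_signal_def)

lemma uminus_add_eq_zero_vec_iff:
  fixes a b :: "'a::ring_1 vec"
  assumes "a \<in> carrier_vec N" "b \<in> carrier_vec N"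
  shows "- a + b = 0\<^sub>v N \<longleftrightarrow> a = b"
proof
  assume *: "- a + b = 0\<^sub>v N"
  have "a $ i = b $ i" if "i < N" for i
    using arg_cong[OF *, of "\<lambda>v. v $ i"] assms that by simp
  thus "a = b" using assms by (intro eq_vecI) auto
qed (use assms in simp)

lemma minus_vec_eq_iff:
  fixes a b w :: "'a::ring_1 vec"
  assumes "a \<in> carrier_vec N" "b \<in> carrier_vec N" "w \<in> carrier_vec N"
  shows "a - w = b \<longleftrightarrow> a = w + b"
proof
  assume *: "a - w = b"
  show "a = w + b" unfolding *[symmetric] using assms by (intro eq_vecI) auto
next
  assume *: "a = w + b"
  show "a - w = b" unfolding * using assms by (intro eq_vecI) auto
qed

lemma system_solution_iff:
  assumes L: "L \<in> carrier_mat N N" and B: "B \<in> carrier_mat N r" and C: "C \<in> carrier_mat r N" and D: "D \<in> carrier_mat r r"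
    and X: "smooth_signal N X" and u: "smooth_signal r u" and y: "smooth_signal r y"
  shows "system_solution r (- L, const_mat B, const_mat C, const_mat D) X u y
    \<longleftrightarrow> (\<forall>t. diff_op L X t = B *\<^sub>v u t) \<and> (\<forall>t. y t = C *\<^sub>v X t + D *\<^sub>v u t)"
proof -
  have eq: "diff_op (four_block_mat (- L) (const_mat B) (const_mat C) (const_mat D)) (\<lambda>s. X s @\<^sub>v u s) t
      = 0\<^sub>v N @\<^sub>v y t \<longleftrightarrow> diff_op L X t = B *\<^sub>v u t \<and> y t = C *\<^sub>v X t + D *\<^sub>v u t" for t
  proof -
    note car = smooth_signal_carrier[OF X] smooth_signal_carrier[OF u] smooth_signal_carrier[OF y]
    have l: "diff_op L X t \<in> carrier_vec N" using L by (intro carrier_vecI) simp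
    have b: "B *\<^sub>v u t \<in> carrier_vec N" using B car by (intro mult_mat_vec_carrier) auto
    have "diff_op (four_block_mat (- L) (const_mat B) (const_mat C) (const_mat D)) (\<lambda>s. X s @\<^sub>v u s) t
      = (- diff_op L X t + B *\<^sub>v u t) @\<^sub>v (C *\<^sub>v X t + D *\<^sub>v u t)"
      using L B C D diff_op_const_mat[where x = u and t = t, OF B car(2)] diff_op_const_mat[where x = X and t = t, OF C car(1)]
        diff_op_const_mat[where x = u and t = t, OF D car(2)]
      by (subst diff_op_four_block[of _ N N _ r _ r, OF _ _ _ _ car(1,2)]) (simp_all add: diff_op_uminus)
    also have "\<dots> = 0\<^sub>v N @\<^sub>v y t \<longleftrightarrow> - diff_op L X t + B *\<^sub>v u t = 0\<^sub>v N \<and> C *\<^sub>v X t + D *\<^sub>v u t = y t"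
      using l b by (intro append_vec_eq[of _ N]) auto
    also have "- diff_op L X t + B *\<^sub>v u t = 0\<^sub>v N \<longleftrightarrow> diff_op L X t = B *\<^sub>v u t"
      by (rule uminus_add_eq_zero_vec_iff[OF l b])
    finally show ?thesis by (auto simp: eq_commute)
  qed
  have "state_dim (- L, const_mat B, const_mat C, const_mat D) = N" using L by simp
  thus ?thesis unfolding system_solution_def using X u y by (auto simp: eq)
qed

lemma diff_op_pencil:
  assumes M: "M \<in> carrier_mat N N" and W: "W \<in> carrier_mat N N" and X: "smooth_signal N X" and b: "b \<in> carrier_vec N"
  shows "diff_op ([:0, 1:] \<cdot>\<^sub>m const_mat M - const_mat W) X t = b
    \<longleftrightarrow> diff_op ([:0, 1:] \<cdot>\<^sub>m const_mat M) X t = W *\<^sub>v X t + b"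
proof -
  note x = smooth_signal_carrier[OF X]
  let ?d = "diff_op ([:0, 1:] \<cdot>\<^sub>m const_mat M) X t"
  have d: "?d \<in> carrier_vec N" using M by (intro carrier_vecI) simp
  have w: "W *\<^sub>v X t \<in> carrier_vec N" using W x by (intro mult_mat_vec_carrier) auto
  have "diff_op ([:0, 1:] \<cdot>\<^sub>m const_mat M - const_mat W) X t = ?d - W *\<^sub>v X t"
    using M W diff_op_const_mat[where x = X and t = t, OF W x] by (subst diff_op_minus[of _ N N]) simp_all
  moreover have "?d - W *\<^sub>v X t = b \<longleftrightarrow> ?d = W *\<^sub>v X t + b" by (rule minus_vec_eq_iff[OF d b w])
  ultimately show ?thesis by simp
qed

section \<open>Regularity and strict system equivalence\<close>

lemma regular_mat_uminus: "regular_mat M \<Longrightarrow> regular_mat (- M)"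
proof -
  assume M: "regular_mat M"
  have "- M = (- 1) \<cdot>\<^sub>m M" by (rule eq_matI) auto
  hence "det (- M) = (- 1) ^ dim_col M * det M" by simp
  thus "regular_mat (- M)" using M by (simp add: regular_mat_def)
qed

text \<open>The outer factors have unit determinants and diag(I, R) has the determinant of
  R.\<close>

lemma regular_pencil_factorization:
  assumes fac: "pencil_factorization n k L R f g" and R: "R \<in> carrier_mat n n" and reg: "regular_mat R"
  shows "regular_mat L"
proof -
  let ?N = "n + k * n" and ?D = "block_diag (k * n) n (1\<^sub>m (k * n)) R"
  obtain U U' V V' where UV: "U \<in> carrier_mat ?N ?N" "U' \<in> carrier_mat ?N ?N" "V \<in> carrier_mat ?N ?N" "V' \<in> carrier_mat ?N ?N"
    and inv: "U * U' = 1\<^sub>m ?N" "V * V' = 1\<^sub>m ?N" and D: "?D \<in> carrier_mat ?N ?N" and L: "L = U * ?D * V"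
    using fac R by (rule pencil_factorizationE)
  have "det U * det U' = 1" "det V * det V' = 1"
    using det_mult[OF UV(1,2)] det_mult[OF UV(3,4)] inv by auto
  hence "det U \<noteq> 0" "det V \<noteq> 0" by auto
  moreover have "det ?D = det R"
    using R by (subst det_four_block_mat_lower_left_zero[of _ "k * n" _ n]) auto
  moreover have "det L = det U * det ?D * det V"
    unfolding L using det_mult[OF mult_carrier_mat[OF UV(1) D] UV(3)] det_mult[OF UV(1) D] by simp
  moreover have "L \<in> carrier_mat ?N ?N" unfolding L using UV D by (intro mult_carrier_mat)
  ultimately show ?thesis using reg by (simp add: regular_mat_def)
qed

text \<open>With q equal to the size of L the second system is not padded, and the first is padded
  by k n identity rows. Its constant blocks then read E^T B and C E, with E the last block row of
  the identity. U carries E^T to the input column and E V is the output row, so the off-diagonal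
  blocks match already with X = Y = 0.\<close>

lemma strict_system_equivalent_factorization:
  fixes B C D :: "complex mat"
  assumes fac: "pencil_factorization n k L P f g" and P: "P \<in> carrier_mat n n" and reg: "regular_mat P"
    and L: "L \<in> carrier_mat (n + k * n) (n + k * n)"
    and deg: "degree (det P) \<le> n + k * n" "degree (det L) \<le> n + k * n"
    and B: "B \<in> carrier_mat n r" and C: "C \<in> carrier_mat r n" and D: "D \<in> carrier_mat r r"
  shows "strict_system_equivalent r r (- P, const_mat B, const_mat C, const_mat D)
    (- L, const_mat (transpose_mat (block_row n (n + k * n) (g * n)) * B), const_mat (C * block_row n (n + k * n) (f * n)), const_mat D)"
    (is "strict_system_equivalent r r ?S1 ?S2")
proof -
  let ?N = "n + k * n" and ?D = "block_diag (k * n) n (1\<^sub>m (k * n)) P"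
  let ?B = "const_mat B" and ?C = "const_mat C"
  let ?E = "block_row n ?N (k * n) :: complex poly mat"
  let ?F = "block_row n ?N (f * n) :: complex poly mat" and ?K = "block_row n ?N (g * n) :: complex poly mat"
  obtain U U' V V' where UV: "U \<in> carrier_mat ?N ?N" "U' \<in> carrier_mat ?N ?N" "V \<in> carrier_mat ?N ?N" "V' \<in> carrier_mat ?N ?N"
    and inv: "U * U' = 1\<^sub>m ?N" "U' * U = 1\<^sub>m ?N" "V * V' = 1\<^sub>m ?N" "V' * V = 1\<^sub>m ?N"
    and Dc: "?D \<in> carrier_mat ?N ?N" and LUV: "L = U * ?D * V"
    and F: "?E * V = ?F" and K: "U * transpose_mat ?E = transpose_mat ?K"
    using fac P by (rule pencil_factorizationE)
  have Bc: "?B \<in> carrier_mat n r" and Cc: "?C \<in> carrier_mat r n" and Dr: "const_mat D \<in> carrier_mat r r"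
    using B C D by auto
  have E: "?E \<in> carrier_mat n ?N" "transpose_mat ?E \<in> carrier_mat ?N n" and Fc: "?F \<in> carrier_mat n ?N"
    and Kc: "transpose_mat ?K \<in> carrier_mat ?N n" by auto
  have S2: "const_mat (transpose_mat (block_row n ?N (g * n)) * B) = transpose_mat ?K * ?B"
    "const_mat (C * block_row n ?N (f * n)) = ?C * ?F"
    using const_mat_mult[OF C block_row_carrier] const_mat_mult[of "transpose_mat (block_row n ?N (g * n))" ?N n, OF _ B]
    by (simp_all add: const_mat_transpose)
  \<comment> \<open>The padding contributes +I but the state block is -P, while -L = -U diag(I, P) V
    asks for a common sign: J diag(I, -P) = -diag(I, P). The last block of J is +I so that E^T is
    left unchanged.\<close>
  let ?J = "block_diag (k * n) n (- 1\<^sub>m (k * n)) (1\<^sub>m n) :: complex poly mat"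
  let ?D1 = "block_diag (k * n) n (1\<^sub>m (k * n)) (- P)"
  have carr: "block_diag (k * n) n M W \<in> carrier_mat ?N ?N"
    if "M \<in> carrier_mat (k * n) (k * n)" "W \<in> carrier_mat n n" for M W :: "complex poly mat"
    using four_block_carrier_mat[OF that] by (simp add: add.commute)
  have J: "?J \<in> carrier_mat ?N ?N" and D1: "?D1 \<in> carrier_mat ?N ?N" using P by (auto intro!: carr)
  have JJ: "?J * ?J = 1\<^sub>m ?N"
    by (subst block_diag_mult) (auto intro!: eq_matI simp: uminus_uminus_mat)
  have JD: "?J * ?D1 = - ?D"
    using P by (subst block_diag_mult) (auto intro!: eq_matI)
  have JE: "?J * transpose_mat ?E = transpose_mat ?E"
    by (subst mult_block_col[OF J]) (auto intro!: eq_matI)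
  let ?U = "U * ?J"
  have Uc: "?U \<in> carrier_mat ?N ?N" using UV J by simp
  have "?U * (?J * U') = 1\<^sub>m ?N" by (rule right_inverse_mult[OF UV(1,2) J J inv(1) JJ])
  hence Uuni: "unimodular_mat ?U" using Uc J UV by (intro unimodular_matI[of _ ?N "?J * U'"]) auto
  have Vuni: "unimodular_mat V'" by (rule unimodular_matI[OF UV(4,3) inv(4)])
  have blocks: "?U * ?D1 = - L * V'" "?U * (transpose_mat ?E * ?B) = transpose_mat ?K * ?B" "?C * ?E = ?C * ?F * V'"
  proof -
    have "L * V' = U * ?D * (V * V')"
      unfolding LUV by (rule assoc_mult_mat[OF mult_carrier_mat[OF UV(1) Dc] UV(3,4)])
    hence "L * V' = U * ?D" unfolding inv(3) right_mult_one_mat[OF mult_carrier_mat[OF UV(1) Dc]] .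
    moreover have "?U * ?D1 = U * (- ?D)" using assoc_mult_mat[OF UV(1) J D1] JD by simp
    moreover have "U * (- ?D) = - (U * ?D)" by (rule uminus_mult_right_mat) (use UV P in simp)
    moreover have "- L * V' = - (L * V')" by (rule uminus_mult_left_mat) (use UV L in simp)
    ultimately show "?U * ?D1 = - L * V'" by simp
    have "?U * (transpose_mat ?E * ?B) = U * (?J * transpose_mat ?E) * ?B"
      using assoc_mult_mat[OF Uc E(2) Bc] assoc_mult_mat[OF UV(1) J E(2)] by simp
    thus "?U * (transpose_mat ?E * ?B) = transpose_mat ?K * ?B" by (simp add: JE K)
    have "?C * ?F * V' = ?C * (?F * V')" by (rule assoc_mult_mat[OF Cc Fc UV(4)])
    also have "?F * V' = ?E * (V * V')" unfolding F[symmetric] by (rule assoc_mult_mat[OF E(1) UV(3,4)])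
    also have "\<dots> = ?E" using inv(3) E by simp
    finally show "?C * ?E = ?C * ?F * V'" by simp
  qed
  have KB: "transpose_mat ?K * ?B \<in> carrier_mat ?N r" by (rule mult_carrier_mat[OF Kc Bc])
  have EB: "transpose_mat ?E * ?B \<in> carrier_mat ?N r" by (rule mult_carrier_mat[OF E(2) Bc])
  have CE: "?C * ?E \<in> carrier_mat r ?N" by (rule mult_carrier_mat[OF Cc E(1)])
  have CF: "?C * ?F \<in> carrier_mat r ?N" by (rule mult_carrier_mat[OF Cc Fc])
  have e1: "extended_system_mat ?N ?S1 = four_block_mat ?D1 (transpose_mat ?E * ?B) (?C * ?E) (const_mat D)"
  proof -
    have "?N - state_dim ?S1 = k * n" using P by simp
    hence "extended_system_mat ?N ?S1 = block_diag (k * n) (n + r) (1\<^sub>m (k * n)) (four_block_mat (- P) ?B ?C (const_mat D))"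
      using P D by (simp add: extended_system_mat_def Let_def)
    also have "\<dots> = four_block_mat ?D1 (transpose_mat ?E * ?B) (?C * ?E) (const_mat D)"
      unfolding block_col_mult[OF Bc] mult_block_row[OF Cc] using P B C D by (auto intro!: eq_matI)
    finally show ?thesis .
  qed
  have e2: "extended_system_mat ?N ?S2 = four_block_mat (- L) (transpose_mat ?K * ?B) (?C * ?F) (const_mat D)"
  proof -
    have "four_block_mat (- L) (transpose_mat ?K * ?B) (?C * ?F) (const_mat D) \<in> carrier_mat (?N + r) (?N + r)"
      using L D by simp
    thus ?thesis using L unfolding S2 by (simp add: extended_system_mat_def Let_def)
  qed
  have "four_block_mat ?U (0\<^sub>m ?N r) (0\<^sub>m r ?N) (1\<^sub>m r) * extended_system_mat ?N ?S1
      = four_block_mat (?U * ?D1) (?U * (transpose_mat ?E * ?B)) (?C * ?E) (const_mat D)"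
    unfolding e1
    using Uc D1 EB CE Dr mult_carrier_mat[OF Uc D1] mult_carrier_mat[OF Uc EB]
    by (subst mult_four_block_mat[of _ ?N ?N _ r _ r _ _ ?N _ r])
      (simp_all add: left_mult_zero_mat[of _ r] left_mult_zero_mat[of _ ?N] left_mult_one_mat[of _ r] carrier_matD[OF B] del: carrier_matD)
  also have "\<dots> = four_block_mat (- L * V') (transpose_mat ?K * ?B) (?C * ?F * V') (const_mat D)"
    unfolding blocks ..
  also have "\<dots> = extended_system_mat ?N ?S2 * four_block_mat V' (0\<^sub>m ?N r) (0\<^sub>m r ?N) (1\<^sub>m r)"
    unfolding e2
    using UV L KB CF Dr mult_carrier_mat[OF uminus_carrier_mat[OF L] UV(4)] mult_carrier_mat[OF CF UV(4)]
    by (subst mult_four_block_mat[of _ ?N ?N _ r _ r _ _ ?N _ r])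
      (simp_all add: right_mult_zero_mat[of _ _ r] right_mult_zero_mat[of _ _ ?N] right_mult_one_mat[of _ _ r] carrier_matD[OF C] del: carrier_matD)
  finally have id: "four_block_mat ?U (0\<^sub>m ?N r) (0\<^sub>m r ?N) (1\<^sub>m r) * extended_system_mat ?N ?S1
    = extended_system_mat ?N ?S2 * four_block_mat V' (0\<^sub>m ?N r) (0\<^sub>m r ?N) (1\<^sub>m r)" .
  have wf: "wf_system r r ?S1" "wf_system r r ?S2"
    using regular_mat_uminus[OF reg] regular_mat_uminus[OF regular_pencil_factorization[OF fac P reg]] B C D P L
    by auto
  have degm: "degree (det (- M)) = degree (det M)" for M :: "complex poly mat"
  proof -
    have "- M = (- 1) \<cdot>\<^sub>m M" by (rule eq_matI) auto
    hence "det (- M) = (- 1) ^ dim_col M * det M" by simp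
    thus ?thesis by (cases "even (dim_col M)") auto
  qed
  have "?N \<ge> max (state_deg ?S1) (state_deg ?S2)" "?N \<ge> state_dim ?S1" "?N \<ge> state_dim ?S2"
    using deg P L by (auto simp: degm)
  with wf id Uc Uuni UV(4) Vuni show ?thesis
    unfolding strict_system_equivalent_def using zero_carrier_mat[of r ?N] zero_carrier_mat[of ?N r] by blast
qed

section \<open>Passing from solutions of the pencil to the higher order system\<close>

lemma matrix_poly_carrier [simp]: "matrix_poly n m A \<in> carrier_mat n n"
  by (simp add: matrix_poly_def)

lemma degree_matrix_poly: "i < n \<Longrightarrow> j < n \<Longrightarrow> degree (matrix_poly n m A $$ (i, j)) \<le> m"
  by (auto simp: matrix_poly_def intro!: degree_sum_le order.trans[OF degree_monom_le])

text \<open>Apply W(d/dt) to the state equation: W L = P F turns its left side into P(d/dt) F X, and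
  W cancels the block column in front of B. The intermediate expression lets W(d/dt) act on the
  input, for which \<open>u\<close> has to be smooth.\<close>

lemma higher_order_solution_from_pencil:
  assumes fac: "pencil_factorization n k L (matrix_poly n m A) f g" and L: "L \<in> carrier_mat (n + k * n) (n + k * n)"
    and B: "B \<in> carrier_mat n r" and C: "C \<in> carrier_mat r n"
    and X: "smooth_signal (n + k * n) X" and u: "smooth_signal r u" and y: "smooth_signal r y"
    and eqL: "\<And>t. diff_op L X t = (transpose_mat (block_row n (n + k * n) (g * n)) * B) *\<^sub>v u t"
    and eqy: "\<And>t. y t = (C * block_row n (n + k * n) (f * n)) *\<^sub>v X t + D *\<^sub>v u t"
  shows "higher_order_solution n m r A B C D (\<lambda>t. block_row n (n + k * n) (f * n) *\<^sub>v X t) u y"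
proof -
  let ?N = "n + k * n"
  let ?F = "block_row n ?N (f * n) :: complex mat" and ?K = "transpose_mat (block_row n ?N (g * n)) :: complex mat"
  let ?P = "matrix_poly n m A"
  note x = smooth_signal_carrier[OF X] smooth_signal_carrier[OF u]
  have F: "?F \<in> carrier_mat n ?N" and K: "?K \<in> carrier_mat ?N n" by auto
  have KB: "?K * B \<in> carrier_mat ?N r" by (rule mult_carrier_mat[OF K B])
  obtain W where W: "W \<in> carrier_mat n ?N" and WL: "W * L = ?P * const_mat ?F"
    and WK: "W * const_mat ?K = 1\<^sub>m n"
    using pencil_factorization_left[OF fac matrix_poly_carrier] by (auto simp: const_mat_transpose)
  have FX: "diff_op (const_mat ?F) X = (\<lambda>t. ?F *\<^sub>v X t)"
    by (rule ext) (rule diff_op_const_mat[OF F x(1)])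
  have LX: "diff_op L X = diff_op (const_mat (?K * B)) u"
    by (rule ext) (simp add: eqL diff_op_const_mat[OF KB x(2)])
  have "diff_op ?P (\<lambda>t. ?F *\<^sub>v X t) t = B *\<^sub>v u t" for t
  proof -
    have "diff_op ?P (\<lambda>t. ?F *\<^sub>v X t) t = diff_op (W * L) X t"
      unfolding FX[symmetric] WL by (rule diff_op_mult[symmetric, OF matrix_poly_carrier const_mat_carrier[OF F] X])
    also have "\<dots> = diff_op W (diff_op (const_mat (?K * B)) u) t"
      unfolding LX[symmetric] by (rule diff_op_mult[OF W L X])
    also have "\<dots> = diff_op (W * const_mat (?K * B)) u t"
      by (rule diff_op_mult[symmetric, OF W const_mat_carrier[OF KB] u])
    also have "W * const_mat (?K * B) = W * const_mat ?K * const_mat B"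
      unfolding const_mat_mult[OF K B]
      by (rule assoc_mult_mat[symmetric, OF W const_mat_carrier[OF K] const_mat_carrier[OF B]])
    also have "\<dots> = const_mat B" unfolding WK using B by simp
    also have "diff_op (const_mat B) u t = B *\<^sub>v u t" by (rule diff_op_const_mat[OF B x(2)])
    finally show ?thesis .
  qed
  moreover have "y t = C *\<^sub>v (?F *\<^sub>v X t) + D *\<^sub>v u t" for t
    unfolding eqy using assoc_mult_mat_vec[OF C F x(1)] by simp
  moreover have "smooth_signal n (\<lambda>t. ?F *\<^sub>v X t)"
    unfolding FX[symmetric] by (rule smooth_signal_diff_op[OF const_mat_carrier[OF F] X])
  ultimately show ?thesis unfolding higher_order_solution_def using u y by blast
qed

text \<open>F and K are defined from a choice of U and V, so the claims on them are made for every
  reduction, beside the existence of one. \<open>fiedler_reduction\<close> pins both to constant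
  matrices, hence all choices yield the same system.\<close>

theorem theorem3p7:
  fixes n m r c1 i1 :: nat
    and A :: "nat \<Rightarrow> complex mat" and B C D :: "complex mat"
    and \<sigma> :: "nat \<Rightarrow> nat" and cs :: "(nat \<times> nat) list"
  assumes "m \<ge> 1"
    and "\<And>j. j \<le> m \<Longrightarrow> A j \<in> carrier_mat n n"
    and "regular_mat (matrix_poly n m A)"
    and "B \<in> carrier_mat n r" and "C \<in> carrier_mat r n" and "D \<in> carrier_mat r r"
    and "bij_betw \<sigma> {0..<m} {1..m}"
    and "is_CISS m \<sigma> ((c1, i1) # cs)"
  shows
    "(\<exists>U V. fiedler_reduction n m A \<sigma> c1 i1 U V) \<and>
     (\<forall>U V. fiedler_reduction n m A \<sigma> c1 i1 U V \<longrightarrow>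
        (\<forall>X u y. smooth_signal (m * n) X \<and> smooth_signal r u \<and> smooth_signal r y \<longrightarrow>
           (system_solution r (fiedler_system n m A B C D \<sigma> c1 i1) X u y \<longleftrightarrow>
              (\<forall>t. diff_op ([:0, 1:] \<cdot>\<^sub>m const_mat (fiedler_mat n m A m)) X t =
                     fiedler_prod n m A \<sigma> *\<^sub>v X t
                     + diff_op (transpose_mat (fiedler_K n m U) * const_mat B) u t) \<and>
              (\<forall>t. y t = diff_op (const_mat C * fiedler_F n m V) X t + D *\<^sub>v u t))) \<and>
        (\<forall>X u y. system_solution r (fiedler_system n m A B C D \<sigma> c1 i1) X u y \<longrightarrow>
           higher_order_solution n m r A B C D (diff_op (fiedler_F n m V) X) u y)) \<and>
     (\<forall>X u y. smooth_signal (m * n) X \<and> smooth_signal r u \<and> smooth_signal r y \<longrightarrow>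
        (c1 > 0 \<longrightarrow>
           (system_solution r (fiedler_system n m A B C D \<sigma> c1 i1) X u y \<longleftrightarrow>
              (\<forall>t. diff_op ([:0, 1:] \<cdot>\<^sub>m const_mat (fiedler_mat n m A m)) X t =
                     fiedler_prod n m A \<sigma> *\<^sub>v X t + (unit_col m m \<otimes>\<^sub>K B) *\<^sub>v u t) \<and>
              (\<forall>t. y t = (unit_row m (m - c1) \<otimes>\<^sub>K C) *\<^sub>v X t + D *\<^sub>v u t))) \<and>
        (c1 = 0 \<longrightarrow>
           (system_solution r (fiedler_system n m A B C D \<sigma> c1 i1) X u y \<longleftrightarrow>
              (\<forall>t. diff_op ([:0, 1:] \<cdot>\<^sub>m const_mat (fiedler_mat n m A m)) X t =
                     fiedler_prod n m A \<sigma> *\<^sub>v X t + (unit_col m (m - i1) \<otimes>\<^sub>K B) *\<^sub>v u t) \<and>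
              (\<forall>t. y t = (unit_row m m \<otimes>\<^sub>K C) *\<^sub>v X t + D *\<^sub>v u t)))) \<and>
     (\<forall>X u y. system_solution r (fiedler_system n m A B C D \<sigma> c1 i1) X u y \<longrightarrow>
        higher_order_solution n m r A B C D
          (\<lambda>t. (unit_row m (m - c1) \<otimes>\<^sub>K 1\<^sub>m n) *\<^sub>v X t) u y) \<and>
     strict_system_equivalent r r
       (higher_order_system n m A B C D) (fiedler_system n m A B C D \<sigma> c1 i1)"
proof -
  note m = assms(1) and A = assms(2) and reg = assms(3) and B = assms(4) and C = assms(5) and D = assms(6)
  obtain k where k: "m = Suc k" using m by (cases m) auto
  have N: "m * n = n + k * n" by (simp add: k)
  \<comment> \<open>Positions counted from 0: the unit vector with index m - c1 sits at offset f n,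
    the one for the input at offset g n. Below, \<open>K\<close> is the block column, that is, the
    transpose of K_\<sigma>(P).\<close>
  define f where "f = m - 1 - c1"
  define g where "g = (if c1 > 0 then m - 1 else m - 1 - i1)"
  define F :: "complex mat" where "F = block_row n (m * n) (f * n)"
  define K :: "complex mat" where "K = transpose_mat (block_row n (m * n) (g * n))"
  let ?L = "fiedler_pencil n m A \<sigma>" and ?P = "matrix_poly n m A"
  let ?S = "fiedler_system n m A B C D \<sigma> c1 i1"
  have le: "c1 + i1 \<le> m - 1" by (rule CISS_block_index(3)[OF assms(8)])
  have fac: "pencil_factorization n k ?L ?P f g"
    using fiedler_pencil_factorization[where A = A, OF m A assms(7,8)] by (simp add: k f_def g_def)
  have Mm: "fiedler_mat n m A m \<in> carrier_mat (m * n) (m * n)" using A m by (intro fiedler_mat_carrier) auto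
  have "fiedler_tail n A (consecution \<sigma>) (m - 1) \<in> carrier_mat (m * n) (m * n)"
    using fiedler_tail_carrier[of "m - 1" A n "consecution \<sigma>"] A by (simp add: N k)
  hence Ms: "fiedler_prod n m A \<sigma> \<in> carrier_mat (m * n) (m * n)"
    by (simp only: fiedler_prod_eq_tail[where A = A, OF A m assms(7)])
  have L: "?L \<in> carrier_mat (m * n) (m * n)" unfolding fiedler_pencil_def
    using Ms by (intro minus_carrier_mat const_mat_carrier)
  have FK: "F \<in> carrier_mat n (m * n)" "K \<in> carrier_mat (m * n) n" by (auto simp: F_def K_def)
  have KB: "K * B \<in> carrier_mat (m * n) r" by (rule mult_carrier_mat[OF FK(2) B])
  have CF: "C * F \<in> carrier_mat r (m * n)" by (rule mult_carrier_mat[OF C FK(1)])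
  have rowF: "unit_row m (m - c1) \<otimes>\<^sub>K Z = Z * F" if "Z \<in> carrier_mat q n" for Z q
    unfolding F_def f_def using unit_row_kron[OF that, of "m - c1" m] le m by (simp add: diff_right_commute)
  have colK: "unit_col m (if c1 > 0 then m else m - i1) \<otimes>\<^sub>K B = K * B"
    unfolding K_def g_def using unit_col_kron[OF B, of "if c1 > 0 then m else m - i1" m] le m
    by (cases "c1 > 0") (simp_all add: diff_right_commute)
  have oneF: "unit_row m (m - c1) \<otimes>\<^sub>K 1\<^sub>m n = F" using rowF[OF one_carrier_mat] FK by simp
  have S: "?S = (- ?L, const_mat (K * B), const_mat (C * F), const_mat D)"
    using colK rowF[OF C] by (cases "c1 > 0") (simp_all add: fiedler_system_def)
  have sol: "system_solution r ?S X u y \<longleftrightarrow>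
      (\<forall>t. diff_op ([:0, 1:] \<cdot>\<^sub>m const_mat (fiedler_mat n m A m)) X t = fiedler_prod n m A \<sigma> *\<^sub>v X t + (K * B) *\<^sub>v u t) \<and>
      (\<forall>t. y t = (C * F) *\<^sub>v X t + D *\<^sub>v u t)"
    and sol': "system_solution r ?S X u y \<longleftrightarrow>
      (\<forall>t. diff_op ?L X t = (K * B) *\<^sub>v u t) \<and> (\<forall>t. y t = (C * F) *\<^sub>v X t + D *\<^sub>v u t)"
    if X: "smooth_signal (m * n) X" and u: "smooth_signal r u" and y: "smooth_signal r y" for X u y
  proof -
    show *: "system_solution r ?S X u y \<longleftrightarrow>
      (\<forall>t. diff_op ?L X t = (K * B) *\<^sub>v u t) \<and> (\<forall>t. y t = (C * F) *\<^sub>v X t + D *\<^sub>v u t)"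
      unfolding S by (rule system_solution_iff[OF L KB CF D X u y])
    have "(K * B) *\<^sub>v u t \<in> carrier_vec (m * n)" for t
      by (rule mult_mat_vec_carrier[OF KB smooth_signal_carrier[OF u]])
    thus "system_solution r ?S X u y \<longleftrightarrow>
      (\<forall>t. diff_op ([:0, 1:] \<cdot>\<^sub>m const_mat (fiedler_mat n m A m)) X t = fiedler_prod n m A \<sigma> *\<^sub>v X t + (K * B) *\<^sub>v u t) \<and>
      (\<forall>t. y t = (C * F) *\<^sub>v X t + D *\<^sub>v u t)"
      unfolding * fiedler_pencil_def by (simp only: diff_op_pencil[OF Mm Ms X])
  qed
  have smooth: "smooth_signal (m * n) X" "smooth_signal r u" "smooth_signal r y"
    if "system_solution r ?S X u y" for X u y
    using that carrier_matD(1)[OF L] unfolding S system_solution_def by simp_all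
  have higher: "higher_order_solution n m r A B C D (\<lambda>t. F *\<^sub>v X t) u y"
    if s: "system_solution r ?S X u y" for X u y
  proof -
    have "\<And>t. diff_op ?L X t = (K * B) *\<^sub>v u t" "\<And>t. y t = (C * F) *\<^sub>v X t + D *\<^sub>v u t"
      using s unfolding sol'[OF smooth[OF s]] by auto
    thus ?thesis
      using higher_order_solution_from_pencil[OF fac L[unfolded N] B C smooth(1)[OF s, unfolded N] smooth(2,3)[OF s]]
      unfolding F_def K_def N by blast
  qed
  have red: "fiedler_F n m V = const_mat F" "transpose_mat (fiedler_K n m U) = const_mat K"
    if "fiedler_reduction n m A \<sigma> c1 i1 U V" for U V
  proof -
    show "fiedler_F n m V = const_mat F" using that oneF unfolding fiedler_reduction_def by simp
    have "fiedler_K n m U = const_mat (unit_row m (if c1 > 0 then m else m - i1) \<otimes>\<^sub>K 1\<^sub>m n)"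
      using that unfolding fiedler_reduction_def by simp
    also have "\<dots> = block_row n (m * n) (g * n)"
      using unit_row_kron_one[of "if c1 > 0 then m else m - i1" m n] le m
      by (cases "c1 > 0") (simp_all add: g_def diff_right_commute)
    finally show "transpose_mat (fiedler_K n m U) = const_mat K"
      by (simp add: K_def const_mat_transpose)
  qed
  have constF: "diff_op (const_mat F) X = (\<lambda>t. F *\<^sub>v X t)" if "smooth_signal (m * n) X" for X
    by (rule ext) (rule diff_op_const_mat[OF FK(1) smooth_signal_carrier[OF that]])
  have op: "diff_op (const_mat K * const_mat B) u t = (K * B) *\<^sub>v u t" if "smooth_signal r u" for u t
    unfolding const_mat_mult[OF FK(2) B, symmetric] by (rule diff_op_const_mat[OF KB smooth_signal_carrier[OF that]])
  have op': "diff_op (const_mat C * const_mat F) X t = (C * F) *\<^sub>v X t" if "smooth_signal (m * n) X" for X t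
    unfolding const_mat_mult[OF C FK(1), symmetric] by (rule diff_op_const_mat[OF CF smooth_signal_carrier[OF that]])
  \<comment> \<open>The degree bounds that make q = m n admissible: entries of degree at most m in a
    determinant of size n, and entries of degree at most 1 in one of size m n.\<close>
  have "degree (det ?P) \<le> m * n"
    using degree_det_le[of n ?P m] degree_matrix_poly by simp
  moreover have "degree (det ?L) \<le> 1 * (m * n)"
  proof (rule degree_det_le[OF _ L])
    fix i j assume "i < m * n" "j < m * n"
    thus "degree (?L $$ (i, j)) \<le> 1"
      using Mm Ms by (auto simp: fiedler_pencil_def intro!: degree_diff_le)
  qed
  ultimately have sse: "strict_system_equivalent r r (higher_order_system n m A B C D) ?S"
    unfolding S higher_order_system_def F_def K_def
    using strict_system_equivalent_factorization[OF fac matrix_poly_carrier reg L[unfolded N] _ _ B C D] unfolding N by simp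
  show ?thesis
  proof (intro conjI allI impI)
    show "\<exists>U V. fiedler_reduction n m A \<sigma> c1 i1 U V"
      by (rule fiedler_reduction_exists[where A = A, OF m A assms(7,8)])
    show "strict_system_equivalent r r (higher_order_system n m A B C D) ?S" by (rule sse)
  next
    fix U V X u y
    assume "fiedler_reduction n m A \<sigma> c1 i1 U V"
      and "smooth_signal (m * n) X \<and> smooth_signal r u \<and> smooth_signal r y"
    thus "system_solution r ?S X u y \<longleftrightarrow>
        (\<forall>t. diff_op ([:0, 1:] \<cdot>\<^sub>m const_mat (fiedler_mat n m A m)) X t =
           fiedler_prod n m A \<sigma> *\<^sub>v X t + diff_op (transpose_mat (fiedler_K n m U) * const_mat B) u t) \<and>
        (\<forall>t. y t = diff_op (const_mat C * fiedler_F n m V) X t + D *\<^sub>v u t)"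
      by (simp only: red op op' sol)
  next
    fix U V X u y
    assume "fiedler_reduction n m A \<sigma> c1 i1 U V" and s: "system_solution r ?S X u y"
    thus "higher_order_solution n m r A B C D (diff_op (fiedler_F n m V) X) u y"
      using higher[OF s] by (simp only: red constF[OF smooth(1)[OF s]])
  next
    fix X u y
    assume "system_solution r ?S X u y"
    thus "higher_order_solution n m r A B C D (\<lambda>t. (unit_row m (m - c1) \<otimes>\<^sub>K 1\<^sub>m n) *\<^sub>v X t) u y"
      unfolding oneF by (rule higher)
  next
    fix X u y
    assume "smooth_signal (m * n) X \<and> smooth_signal r u \<and> smooth_signal r y" and "c1 > 0"
    thus "system_solution r ?S X u y \<longleftrightarrow>
        (\<forall>t. diff_op ([:0, 1:] \<cdot>\<^sub>m const_mat (fiedler_mat n m A m)) X t =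
           fiedler_prod n m A \<sigma> *\<^sub>v X t + (unit_col m m \<otimes>\<^sub>K B) *\<^sub>v u t) \<and>
        (\<forall>t. y t = (unit_row m (m - c1) \<otimes>\<^sub>K C) *\<^sub>v X t + D *\<^sub>v u t)"
      using colK by (simp add: sol rowF[OF C])
  next
    fix X u y
    assume "smooth_signal (m * n) X \<and> smooth_signal r u \<and> smooth_signal r y" and "c1 = 0"
    thus "system_solution r ?S X u y \<longleftrightarrow>
        (\<forall>t. diff_op ([:0, 1:] \<cdot>\<^sub>m const_mat (fiedler_mat n m A m)) X t =
           fiedler_prod n m A \<sigma> *\<^sub>v X t + (unit_col m (m - i1) \<otimes>\<^sub>K B) *\<^sub>v u t) \<and>
        (\<forall>t. y t = (unit_row m m \<otimes>\<^sub>K C) *\<^sub>v X t + D *\<^sub>v u t)"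
      using colK rowF[OF C] sol[of X u y] by simp
  qed
qed

end
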